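(* Let $\gamma := 1.0321$, $p := \gamma^{40}$ $(=3.538923071\ldots)$ and $q := \gamma^{31}$ $(=2.663024240\ldots)$. Let $K$ be the regular Cantor set with convex hull $[0,1]$, Markov partition $\{[0,\frac1p],[1-\frac1p,1]\}$ and expanding map $\phi(x)=px$ for $x\in[0,\frac1p]$, $\phi(x)=px-p+1$ for $x\in[1-\frac1p,1]$. Let $K'$ be the regular Cantor set with convex hull $[0,1]$, Markov partition $\{[0,\frac1q],[1-\frac1q,1]\}$ and expanding map $\phi'(x)=qx$ for $x\in[0,\frac1q]$, $\phi'(x)=qx-q+1$ for $x\in[1-\frac1q,1]$. Then the pair $(K,K')$ has stable intersection, while $\tau(K)\cdot\tau(K')<1$, where $\tau$ denotes the Newhouse thickness.
   Context: **Regular Cantor set.** A Cantor set $K\subset\mathbb{R}$ is regular (dynamically defined) if: (i) there are disjoint compact intervals $K_1,\dots,K_r$ with $K\subset K_1\cup\dots\cup K_r$ and the boundary of each $K_i$ contained in $K$; (ii) there are $\epsilon>0$ and a $C^{1+\epsilon}$ expanding map $\psi$ (i.e. $|D\psi|>1$) defined in a neighborhood of $K_1\cup\dots\cup K_r$ such that each $\psi(K_i)$ is the convex hull of a finite union of some of the intervals $K_j$, and (ii.1) for each $i$ and all sufficiently large $n$, $\psi^n(K\cap K_i)=K$; (ii.2) $K=\bigcap_{n\ge 0}\psi^{-n}(K_1\cup\dots\cup K_r)$. The set $\{K_1,\dots,K_r\}$ is the Markov partition of $K$ and $\psi$ its expanding map. **Closeness.** A regular Cantor set $\widetilde K$ with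 Markov partition $\{\widetilde K_1,\dots,\widetilde K_s\}$ and expanding map $\widetilde\psi$ is close to $K$ (with data $\{K_1,\dots,K_r\}$, $\psi$) in the $C^{1+\epsilon}$ topology if $r=s$, the endpoints of each $\widetilde K_i$ are near the corresponding endpoints of $K_i$, and, supposing $\psi\in C^{1+\epsilon}$ with Hölder constant $C$ (for $D\psi$), one has $\widetilde\psi\in C^{1+\widetilde\epsilon}$ with Hölder constant $\widetilde C$ such that $(\widetilde C,\widetilde\epsilon)$ is near $(C,\epsilon)$, and $\widetilde\psi$ is close to $\psi$ in the $C^1$ topology. Quantitatively: given $(C,\epsilon)$ with $C,\epsilon>0$ such that $|D\psi(x)-D\psi(y)|\le C|x-y|^{\epsilon}$ for $x,y$ in the same interval $K_i$, say $\widetilde K$ is $\delta$-close to $K$ if $r=s$, corresponding endpoints differ by less than $\delta$, there is $(\widetilde C,\widetilde\epsilon)$ with $\widetilde\epsilon>0$, $|\widetilde C-C|<\delta$, $|\widetilde\epsilon-\epsilon|<\delta$ and $|D\widetilde\psi(x)-D\widetilde\psi(y)|\le\widetilde C|x-y|^{\widetilde\epsilon}$ for $x,y$ in the same $\widetilde K_i$, and, with $A_i:K_i\to\widetilde K_i$ the increasing affine bijection, $|\widetilde\psi\circ A_i-\psi|<\delta$ and $|D(\widetilde\psi\circ A_i)-D\psi|<\delta$ on $K_i$ for every $i$. **Stable intersection.** Regular Cantor sets $K,K'$ have stable intersection if for every pair of regular Cantor sets $(\widetilde K,\widetilde K')$ near $(K,K')$ one has $\widetilde K\cap\widetilde K'\ne\emptyset$;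 that is, for every choice of Hölder data $(C,\epsilon)$ for $K$ and $(C',\epsilon')$ for $K'$ there is $\delta>0$ such that $\widetilde K\cap\widetilde K'\neq\emptyset$ whenever $\widetilde K$ is $\delta$-close to $K$ and $\widetilde K'$ is $\delta$-close to $K'$. **Thickness.** A gap of $K$ is a connected component of $\mathbb{R}\setminus K$. For a bounded gap $U$ of $K$, let $L_U$ and $R_U$ be the intervals at its left and at its right, respectively, that separate $U$ from the closest larger gaps (unbounded gaps count as larger). Put $\tau_R(U)=|R_U|/|U|$, $\tau_L(U)=|L_U|/|U|$, $\tau_R(K)=\inf_U\tau_R(U)$, $\tau_L(K)=\inf_U\tau_L(U)$ (infima over all bounded gaps), and $\tau(K)=\min\{\tau_R(K),\tau_L(K)\}$. *)

theory Defs
  imports "HOL-Analysis.Analysis"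
begin

definition cantor_set :: "real set \<Rightarrow> bool" where
  "cantor_set K \<longleftrightarrow> K \<noteq> {} \<and> compact K \<and> (\<forall>x\<in>K. x islimpt K) \<and>
     (\<forall>x\<in>K. connected_component_set K x = {x})"


text \<open>A Markov partition is the list of the endpoint pairs of its intervals; the position in
  the list is the label of an interval.\<close>

definition piece :: "(real \<times> real) list \<Rightarrow> nat \<Rightarrow> real set" where
  "piece P i = {fst (P ! i)..snd (P ! i)}"

definition pieces :: "(real \<times> real) list \<Rightarrow> real set" where
  "pieces P = (\<Union>i<length P. piece P i)"

text \<open>The expanding map is a total function, but only its values near the intervals matter: a
  point of the intersection in the last clause has its whole forward orbit in the intervals.\<close>

definition regular_cantor_set ::
    "real set \<Rightarrow> (real \<times> real) list \<Rightarrow> (real \<Rightarrow> real) \<Rightarrow> bool" where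
  "regular_cantor_set K P \<psi> \<longleftrightarrow>
     cantor_set K \<and>
     (\<forall>i<length P. fst (P ! i) < snd (P ! i)) \<and>
     disjoint_family_on (piece P) {..<length P} \<and>
     K \<subseteq> pieces P \<and>
     (\<forall>i<length P. frontier (piece P i) \<subseteq> K) \<and>
     (\<exists>\<epsilon>>0. \<exists>U C. open U \<and> pieces P \<subseteq> U \<and>
        (\<forall>x\<in>U. \<psi> differentiable (at x) \<and> \<bar>deriv \<psi> x\<bar> > 1) \<and>
        (\<forall>x\<in>U. \<forall>y\<in>U. \<bar>deriv \<psi> x - deriv \<psi> y\<bar> \<le> C * \<bar>x - y\<bar> powr \<epsilon>)) \<and>
     (\<forall>i<length P. \<exists>J\<subseteq>{..<length P}. \<psi> ` piece P i = convex hull (\<Union>j\<in>J. piece P j)) \<and>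
     (\<forall>i<length P. \<forall>\<^sub>F n in sequentially. (\<psi> ^^ n) ` (K \<inter> piece P i) = K) \<and>
     K = (\<Inter>n. (\<psi> ^^ n) -` pieces P)"


definition holder_deriv :: "(real \<times> real) list \<Rightarrow> (real \<Rightarrow> real) \<Rightarrow> real \<Rightarrow> real \<Rightarrow> bool" where
  "holder_deriv P \<psi> C \<epsilon> \<longleftrightarrow>
     (\<forall>i<length P. \<forall>x\<in>piece P i. \<forall>y\<in>piece P i.
        \<bar>deriv \<psi> x - deriv \<psi> y\<bar> \<le> C * \<bar>x - y\<bar> powr \<epsilon>)"

definition affine_onto :: "real \<times> real \<Rightarrow> real \<times> real \<Rightarrow> real \<Rightarrow> real" where
  "affine_onto I J x = fst J + (x - fst I) * (snd J - fst J) / (snd I - fst I)"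

text \<open>Closeness of the Cantor set with partition \<open>Q\<close> and map \<open>\<eta>\<close> to the one with partition \<open>P\<close>
  and map \<open>\<psi>\<close>, whose Hoelder data are \<open>(C, \<epsilon>)\<close>. Both sets are determined by these data.\<close>

definition delta_close ::
    "real \<Rightarrow> real \<Rightarrow> real \<Rightarrow> (real \<times> real) list \<Rightarrow> (real \<Rightarrow> real) \<Rightarrow>
     (real \<times> real) list \<Rightarrow> (real \<Rightarrow> real) \<Rightarrow> bool" where
  "delta_close \<delta> C \<epsilon> P \<psi> Q \<eta> \<longleftrightarrow>
     length Q = length P \<and>
     (\<forall>i<length P. \<bar>fst (Q ! i) - fst (P ! i)\<bar> < \<delta> \<and> \<bar>snd (Q ! i) - snd (P ! i)\<bar> < \<delta>) \<and>
     (\<exists>C' \<epsilon>'. \<epsilon>' > 0 \<and> \<bar>C' - C\<bar> < \<delta> \<and> \<bar>\<epsilon>' - \<epsilon>\<bar> < \<delta> \<and> holder_deriv Q \<eta> C' \<epsilon>') \<and>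
     (\<forall>i<length P. \<forall>x\<in>piece P i.
        \<bar>(\<eta> \<circ> affine_onto (P ! i) (Q ! i)) x - \<psi> x\<bar> < \<delta> \<and>
        \<bar>deriv (\<eta> \<circ> affine_onto (P ! i) (Q ! i)) x - deriv \<psi> x\<bar> < \<delta>)"

definition stable_intersection ::
    "real set \<Rightarrow> (real \<times> real) list \<Rightarrow> (real \<Rightarrow> real) \<Rightarrow>
     real set \<Rightarrow> (real \<times> real) list \<Rightarrow> (real \<Rightarrow> real) \<Rightarrow> bool" where
  "stable_intersection K P \<psi> K' P' \<psi>' \<longleftrightarrow>
     regular_cantor_set K P \<psi> \<and> regular_cantor_set K' P' \<psi>' \<and>
     (\<forall>C>0. \<forall>\<epsilon>>0. \<forall>C'>0. \<forall>\<epsilon>'>0. holder_deriv P \<psi> C \<epsilon> \<longrightarrow> holder_deriv P' \<psi>' C' \<epsilon>' \<longrightarrow>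
        (\<exists>\<delta>>0. \<forall>L Q \<eta> L' Q' \<eta>'.
           regular_cantor_set L Q \<eta> \<longrightarrow> regular_cantor_set L' Q' \<eta>' \<longrightarrow>
           delta_close \<delta> C \<epsilon> P \<psi> Q \<eta> \<longrightarrow> delta_close \<delta> C' \<epsilon>' P' \<psi>' Q' \<eta>' \<longrightarrow>
           L \<inter> L' \<noteq> {}))"


definition gaps :: "real set \<Rightarrow> real set set" where
  "gaps K = components (- K)"

definition bounded_gaps :: "real set \<Rightarrow> real set set" where
  "bounded_gaps K = {U \<in> gaps K. bounded U}"

definition larger_gap :: "real set \<Rightarrow> real set \<Rightarrow> real set \<Rightarrow> bool" where
  "larger_gap K U V \<longleftrightarrow> V \<in> gaps K \<and> (bounded V \<longrightarrow> measure lborel V > measure lborel U)"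

definition set_before :: "real set \<Rightarrow> real set \<Rightarrow> bool" where
  "set_before A B \<longleftrightarrow> (\<forall>a\<in>A. \<forall>b\<in>B. a \<le> b)"

text \<open>The closed interval from \<open>U\<close> to the closest larger gap on the left, respectively right.\<close>

definition left_bridge :: "real set \<Rightarrow> real set \<Rightarrow> real set" where
  "left_bridge K U = {x. set_before {x} U \<and>
     (\<forall>V. larger_gap K U V \<and> set_before V U \<longrightarrow> set_before V {x})}"

definition right_bridge :: "real set \<Rightarrow> real set \<Rightarrow> real set" where
  "right_bridge K U = {x. set_before U {x} \<and>
     (\<forall>V. larger_gap K U V \<and> set_before U V \<longrightarrow> set_before {x} V)}"

definition left_thickness :: "real set \<Rightarrow> real" where
  "left_thickness K =
     (INF U\<in>bounded_gaps K. measure lborel (left_bridge K U) / measure lborel U)"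

definition right_thickness :: "real set \<Rightarrow> real" where
  "right_thickness K =
     (INF U\<in>bounded_gaps K. measure lborel (right_bridge K U) / measure lborel U)"

definition thickness :: "real set \<Rightarrow> real" where
  "thickness K = min (right_thickness K) (left_thickness K)"


text \<open>Consistency check: regular Cantor sets with two full affine branches exist.\<close>

lemma regular_cantor_set_affine:
  fixes p :: real
  assumes p: "p > 2"
  shows "\<exists>K \<phi>. regular_cantor_set K [(0, 1 / p), (1 - 1 / p, 1)] \<phi> \<and> convex hull K = {0..1} \<and>
    (\<forall>x\<in>{0..1 / p}. \<phi> x = p * x) \<and> (\<forall>x\<in>{1 - 1 / p..1}. \<phi> x = p * x - p + 1)"
proof -
  define P where "P = [(0, 1 / p), (1 - 1 / p, 1)]"
  define S where "S = {0..1 / p} \<union> {1 - 1 / p..1}"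
  define f where "f = (\<lambda>x. if x < 1/2 then p * x else p * x - p + 1)"
  define g where "g = (\<lambda>y. y / p)"
  define h where "h = (\<lambda>y. y / p + (1 - 1 / p))"
  define K where "K = (\<Inter>n. (f ^^ n) -` S)"
  have ip: "1 / p > 0" "1 / p < 1 / 2" using p by (auto simp: field_simps)
  have piece: "piece P 0 = {0..1 / p}" "piece P (Suc 0) = {1 - 1 / p..1}"
    by (auto simp: P_def piece_def)
  have len: "length P = 2" "{..<2::nat} = {0, Suc 0}" by (auto simp: P_def)
  have PS: "pieces P = S" by (auto simp: pieces_def S_def len piece)
  have cases: "(x \<in> {0..1/p} \<and> x < 1/2 \<and> 0 \<le> p * x \<and> p * x \<le> 1 \<and> f x = p * x) \<or>
      (x \<in> {1 - 1/p..1} \<and> x \<ge> 1/2 \<and> p - 1 \<le> p * x \<and> p * x \<le> p \<and> f x = p * x - p + 1)"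
    if "x \<in> S" for x
  proof (cases "x \<in> {0..1/p}")
    case True
    hence "x < 1/2" using ip unfolding atLeastAtMost_iff by linarith
    thus ?thesis using True p by (auto simp: f_def field_simps)
  next
    case False
    hence x: "x \<in> {1 - 1/p..1}" using that by (auto simp: S_def)
    hence "x \<ge> 1/2" using ip unfolding atLeastAtMost_iff by linarith
    thus ?thesis using x p by (auto simp: f_def field_simps)
  qed
  have fS: "f x \<in> {0..1}" if "x \<in> S" for x
    using cases[OF that] by auto
  have g: "g y \<in> {0..1/p}" "f (g y) = y" and h: "h y \<in> {1 - 1/p..1}" "f (h y) = y"
    if "y \<in> {0..1}" for y
  proof -
    have "y / p \<ge> 0" "y / p \<le> 1 / p" using that p by (auto simp: field_simps)
    thus "g y \<in> {0..1/p}" "h y \<in> {1 - 1/p..1}" by (auto simp: g_def h_def)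
    have "y / p < 1/2" "y / p + (1 - 1/p) \<ge> 1/2" using \<open>y/p \<ge> 0\<close> \<open>y / p \<le> 1 / p\<close> ip by linarith+
    thus "f (g y) = y" "f (h y) = y" using p by (auto simp: f_def g_def h_def field_simps)
  qed
  have inv: "(x \<in> {0..1/p} \<and> x = g (f x)) \<or> (x \<in> {1-1/p..1} \<and> x = h (f x))" if "x \<in> S" for x
    using cases[OF that] p by (auto simp: g_def h_def diff_divide_distrib add_divide_distrib)
  have K_iff: "x \<in> K \<longleftrightarrow> (\<forall>n. (f ^^ n) x \<in> S)" for x by (auto simp: K_def)
  have KS: "K \<subseteq> S" using K_iff by (metis funpow_0 subsetI)
  have S01: "S \<subseteq> {0..1}" using ip by (auto simp: S_def)
  have K_step: "x \<in> K \<longleftrightarrow> x \<in> S \<and> f x \<in> K" for x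
  proof -
    have "(\<forall>n. (f ^^ n) x \<in> S) \<longleftrightarrow> (f ^^ 0) x \<in> S \<and> (\<forall>n. (f ^^ Suc n) x \<in> S)"
      by (metis not0_implies_Suc)
    thus ?thesis unfolding K_iff by (simp add: funpow_swap1)
  qed
  have gK: "g y \<in> K \<inter> {0..1/p}" "f (g y) = y" and hK: "h y \<in> K \<inter> {1-1/p..1}" "f (h y) = y"
    if "y \<in> K" for y
  proof -
    have y: "y \<in> {0..1}" using that KS S01 by blast
    show "f (g y) = y" "f (h y) = y" using g[OF y] h[OF y] by auto
    show "g y \<in> K \<inter> {0..1/p}" "h y \<in> K \<inter> {1-1/p..1}"
      using g[OF y] h[OF y] that K_step[of "g y"] K_step[of "h y"] by (auto simp: S_def)
  qed
  have f01: "f 0 = 0" "f 1 = 1" by (auto simp: f_def)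
  have "(f ^^ n) 0 = 0" "(f ^^ n) 1 = 1" for n by (induction n) (auto simp: f01)
  hence K01: "0 \<in> K" "1 \<in> K" using ip by (auto simp: K_iff S_def)
  have fK: "f ` (K \<inter> {0..1/p}) = K" "f ` (K \<inter> {1-1/p..1}) = K"
  proof -
    have 1: "f ` (K \<inter> T) \<subseteq> K" for T using K_step by blast
    have "y \<in> f ` (K \<inter> {0..1/p})" "y \<in> f ` (K \<inter> {1-1/p..1})" if "y \<in> K" for y
      using gK[OF that] hK[OF that] by (metis image_eqI)+
    thus "f ` (K \<inter> {0..1/p}) = K" "f ` (K \<inter> {1-1/p..1}) = K" using 1 by blast+
  qed
  have fKK: "f ` K = K" using K_step fK(1) by blast
  have fnK: "(f ^^ n) ` K = K" for n
  proof (induction n)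
    case (Suc n)
    have "(f ^^ Suc n) ` K = f ` ((f ^^ n) ` K)" by (simp add: image_comp)
    thus ?case by (simp only: Suc fKK)
  qed simp
  have expand: "(f ^^ n) ` (K \<inter> T) = K" if "f ` (K \<inter> T) = K" "n \<ge> 1" for n T
  proof -
    obtain m where n: "n = Suc m" using \<open>n \<ge> 1\<close> by (cases n) auto
    have "(f ^^ n) ` (K \<inter> T) = (f ^^ m) ` (f ` (K \<inter> T))"
      unfolding n funpow_Suc_right image_comp ..
    thus ?thesis using that fnK by simp
  qed
  define Kn where "Kn = (\<lambda>n. {x. \<forall>m\<le>n. (f ^^ m) x \<in> S})"
  have Kn_Suc: "Kn (Suc n) = g ` (Kn n) \<union> h ` (Kn n)" for n
  proof -
    have 1: "x \<in> Kn (Suc n) \<longleftrightarrow> x \<in> S \<and> f x \<in> Kn n" for x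
    proof -
      have "(\<forall>m\<le>Suc n. (f ^^ m) x \<in> S) \<longleftrightarrow> (f ^^ 0) x \<in> S \<and> (\<forall>m\<le>n. (f ^^ Suc m) x \<in> S)"
        by (metis Suc_le_mono not0_implies_Suc zero_le)
      thus ?thesis unfolding Kn_def by (simp add: funpow_swap1)
    qed
    have 2: "y \<in> {0..1}" if "y \<in> Kn n" for y
      using that S01 unfolding Kn_def by (auto dest!: spec[of _ 0])
    show ?thesis
    proof (intro equalityI subsetI)
      fix x assume "x \<in> Kn (Suc n)"
      thus "x \<in> g ` (Kn n) \<union> h ` (Kn n)" using 1[of x] inv[of x] by blast
    next
      fix x assume "x \<in> g ` (Kn n) \<union> h ` (Kn n)"
      then obtain y where y: "y \<in> Kn n" "x = g y \<or> x = h y" by blast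
      thus "x \<in> Kn (Suc n)" using 1[of x] 2[OF y(1)] g[of y] h[of y] by (auto simp: S_def)
    qed
  qed
  have "compact (Kn n)" for n
  proof (induction n)
    case 0
    have "Kn 0 = S" by (simp add: Kn_def)
    thus ?case unfolding S_def by (simp only: compact_Un compact_Icc)
  next
    case (Suc n)
    show ?case unfolding Kn_Suc
      by (intro compact_Un compact_continuous_image Suc)
         (use p in \<open>auto simp: g_def h_def intro!: continuous_intros\<close>)
  qed
  moreover have "K = (\<Inter>n. Kn n)" unfolding Kn_def K_def by auto
  ultimately have "closed K" by (simp add: closed_INT compact_imp_closed)
  hence cK: "compact K"
    using KS S01 by (meson compact_Icc compact_imp_bounded bounded_subset compact_eq_bounded_closed subset_trans)
  have lim: "x islimpt K" if "x \<in> K" for x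
  proof -
    have *: "\<exists>y\<in>K. y \<noteq> x \<and> \<bar>x - y\<bar> \<le> (1/p) ^ n" if "x \<in> K" for x n
      using that
    proof (induction n arbitrary: x)
      case 0
      have "x \<in> {0..1}" using 0 KS S01 by blast
      thus ?case using K01 by (cases "x = 0") (auto intro: bexI[of _ 1] bexI[of _ 0])
    next
      case (Suc n)
      then obtain y where y: "y \<in> K" "y \<noteq> f x" "\<bar>f x - y\<bar> \<le> (1/p) ^ n"
        using K_step by blast
      have "\<bar>f x - y\<bar> / p \<le> (1/p) ^ n / p" using y p by (simp add: divide_right_mono)
      also have "(1/p) ^ n / p = (1/p) ^ Suc n" by simp
      finally have 1: "\<bar>f x - y\<bar> / p \<le> (1/p) ^ Suc n" .
      have "g (f x) - g y = (f x - y) / p" "h (f x) - h y = (f x - y) / p"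
        by (simp_all add: g_def h_def diff_divide_distrib)
      hence "\<bar>g (f x) - g y\<bar> \<le> (1/p) ^ Suc n" "\<bar>h (f x) - h y\<bar> \<le> (1/p) ^ Suc n"
        using 1 p by (simp_all only: abs_divide)
      moreover have "x = g (f x) \<or> x = h (f x)" using inv Suc.prems KS by blast
      moreover have "g y \<noteq> x" "h y \<noteq> x" using gK hK y by auto
      moreover have "g y \<in> K" "h y \<in> K" using gK[OF y(1)] hK[OF y(1)] by auto
      ultimately show ?case by metis
    qed
    show ?thesis unfolding islimpt_approachable
    proof (intro allI impI)
      fix e :: real assume "e > 0"
      then obtain n where "(1/p) ^ n < e" using ip real_arch_pow_inv[of e "1/p"] by auto
      thus "\<exists>x'\<in>K. x' \<noteq> x \<and> dist x' x < e" using *[OF that, of n]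
        by (force simp: dist_real_def abs_minus_commute)
    qed
  qed
  have short: "y - x \<le> (1/p) ^ n" if "{x..y} \<subseteq> K" "x \<le> y" for x y n
    using that
  proof (induction n arbitrary: x y)
    case 0
    have "x \<in> K" "y \<in> K" using 0 by auto
    hence "x \<in> {0..1}" "y \<in> {0..1}" using KS S01 by blast+
    thus ?case by simp
  next
    case (Suc n)
    have "1/2 \<notin> S" using ip by (auto simp: S_def)
    hence "1/2 \<notin> {x..y}" using Suc.prems KS by blast
    hence c: "y < 1/2 \<or> x > 1/2" by auto
    have 1: "f y - f x = p * (y - x)" using c Suc.prems by (auto simp: f_def algebra_simps)
    have le: "f x \<le> f y" using 1 p Suc.prems by (smt (verit) mult_nonneg_nonneg)
    have "z \<in> K" if z: "z \<in> {f x..f y}" for z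
    proof -
      define w where "w = x + (z - f x) / p"
      have "(z - f x) / p \<ge> 0" "(z - f x) / p \<le> (f y - f x) / p"
        using z p by (auto intro: divide_right_mono)
      moreover have "(f y - f x) / p = y - x" unfolding 1 using p by simp
      ultimately have w: "w \<in> {x..y}" by (auto simp: w_def)
      hence "f w - f x = p * (w - x)" using c by (auto simp: f_def algebra_simps)
      hence "f w = z" using p by (simp add: w_def)
      thus ?thesis using w Suc.prems K_step by blast
    qed
    hence "f y - f x \<le> (1/p) ^ n" using Suc.IH[OF _ le] by blast
    thus ?case using 1 p by (simp add: field_simps)
  qed
  have disc: "connected_component_set K x = {x}" if "x \<in> K" for x
  proof -
    have eq: "a = b" if ab: "a \<in> connected_component_set K x" "b \<in> connected_component_set K x"
      "a \<le> b" for a b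
    proof -
      have "{a..b} \<subseteq> connected_component_set K x"
        using connected_contains_Icc[OF connected_connected_component] ab by blast
      hence "{a..b} \<subseteq> K" using connected_component_subset by blast
      hence *: "b - a \<le> (1/p) ^ n" for n using short ab by blast
      show ?thesis
      proof (rule ccontr)
        assume "a \<noteq> b"
        then obtain n where "(1/p) ^ n < b - a"
          using ip real_arch_pow_inv[of "b - a" "1/p"] ab by auto
        thus False using *[of n] by simp
      qed
    qed
    have x: "x \<in> connected_component_set K x" using that by simp
    have "y = x" if "y \<in> connected_component_set K x" for y
      using eq[OF x that] eq[OF that x] linear[of x y] by blast
    thus ?thesis using x by blast
  qed
  have fd: "(f has_field_derivative p) (at x)" if "x \<noteq> 1/2" for x
  proof (cases "x < 1/2")
    case True
    have "((\<lambda>x. p * x) has_field_derivative p) (at x)" by (auto intro!: derivative_eq_intros)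
    thus ?thesis
      by (rule has_field_derivative_transform_within_open[of _ _ _ "{..<1/2}"])
         (use True in \<open>auto simp: f_def\<close>)
  next
    case False
    have "((\<lambda>x. p * x - p + 1) has_field_derivative p) (at x)" by (auto intro!: derivative_eq_intros)
    thus ?thesis
      by (rule has_field_derivative_transform_within_open[of _ _ _ "{1/2<..}"])
         (use False that in \<open>auto simp: f_def\<close>)
  qed
  have fimg: "f ` {0..1/p} = {0..1}" "f ` {1-1/p..1} = {0..1}"
  proof -
    have "y \<in> f ` {0..1/p}" "y \<in> f ` {1-1/p..1}" if "y \<in> {0..1}" for y
      using g[OF that] h[OF that] by (metis image_eqI)+
    moreover have "f ` {0..1/p} \<subseteq> {0..1}" "f ` {1-1/p..1} \<subseteq> {0..1}"
      using fS unfolding S_def by blast+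
    ultimately show "f ` {0..1/p} = {0..1}" "f ` {1-1/p..1} = {0..1}" by blast+
  qed
  have hull: "convex hull T = {0..1}" if "0 \<in> T" "1 \<in> T" "T \<subseteq> {0..1}" for T :: "real set"
  proof
    show "convex hull T \<subseteq> {0..1}" using that by (intro hull_minimal) auto
    have "convex hull {0, 1} \<subseteq> convex hull T" using that by (intro hull_mono) auto
    thus "{0..1} \<subseteq> convex hull T"
      by (simp add: segment_convex_hull[symmetric] closed_segment_eq_real_ivl)
  qed
  have end_pts: "1/p \<in> K" "1 - 1/p \<in> K"
    using gK(1)[OF K01(2)] hK(1)[OF K01(1)] by (auto simp: g_def h_def)
  have reg: "regular_cantor_set K P f"
    unfolding regular_cantor_set_def
  proof (intro conjI)
    show "cantor_set K" unfolding cantor_set_def using K01 cK lim disc by blast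
    show "\<forall>i<length P. fst (P ! i) < snd (P ! i)"
      using ip by (auto simp: P_def less_Suc_eq)
    show "disjoint_family_on (piece P) {..<length P}"
      using ip by (auto simp: disjoint_family_on_def len piece)
    show "K \<subseteq> pieces P" using KS PS by simp
    show "\<forall>i<length P. frontier (piece P i) \<subseteq> K"
    proof -
      have "frontier {0..1/p} = {0, 1/p}" "frontier {1-1/p..1} = {1-1/p, 1}"
        using ip by (auto simp: frontier_def)
      thus ?thesis using K01 end_pts by (auto simp: len less_Suc_eq numeral_2_eq_2 piece)
    qed
    show "\<exists>\<epsilon>>0. \<exists>U C. open U \<and> pieces P \<subseteq> U \<and>
        (\<forall>x\<in>U. f differentiable (at x) \<and> \<bar>deriv f x\<bar> > 1) \<and>
        (\<forall>x\<in>U. \<forall>y\<in>U. \<bar>deriv f x - deriv f y\<bar> \<le> C * \<bar>x - y\<bar> powr \<epsilon>)"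
    proof (rule exI[of _ 1], intro conjI exI[of _ "- {1/2}"] exI[of _ 0])
      have "deriv f x = p" if "x \<in> - {1/2}" for x using fd[of x] that DERIV_imp_deriv by auto
      moreover have "f differentiable (at x)" if "x \<in> - {1/2}" for x
        using fd[of x] that unfolding real_differentiable_def by auto
      ultimately show "\<forall>x\<in>-{1/2}. f differentiable (at x) \<and> \<bar>deriv f x\<bar> > 1"
        "\<forall>x\<in>-{1/2}. \<forall>y\<in>-{1/2}. \<bar>deriv f x - deriv f y\<bar> \<le> 0 * \<bar>x - y\<bar> powr 1"
        using p by simp_all
    qed (use ip PS S_def in auto)
    show "\<forall>i<length P. \<exists>J\<subseteq>{..<length P}. f ` piece P i = convex hull (\<Union>j\<in>J. piece P j)"
    proof (intro allI impI exI[of _ "{..<length P}"] conjI)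
      fix i assume "i < length P"
      moreover have "(\<Union>j<length P. piece P j) = S" using PS by (simp add: pieces_def)
      moreover have "convex hull S = {0..1}" using S01 ip by (intro hull) (auto simp: S_def)
      ultimately show "f ` piece P i = convex hull (\<Union>j<length P. piece P j)"
        using fimg by (auto simp: len less_Suc_eq numeral_2_eq_2 piece)
    qed auto
    show "\<forall>i<length P. \<forall>\<^sub>F n in sequentially. (f ^^ n) ` (K \<inter> piece P i) = K"
    proof (intro allI impI eventually_sequentiallyI[of 1])
      fix i n :: nat assume "i < length P" "1 \<le> n"
      hence "i = 0 \<or> i = Suc 0" "1 \<le> n" by (auto simp: len)
      thus "(f ^^ n) ` (K \<inter> piece P i) = K"
        using expand[OF fK(1)] expand[OF fK(2)] piece by metis
    qed
    show "K = (\<Inter>n. (f ^^ n) -` pieces P)" by (simp add: PS K_def)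
  qed
  have hullK: "convex hull K = {0..1}" using K01 KS S01 by (intro hull) auto
  have "f x = p * x" if "x \<in> {0..1/p}" for x
    using that ip unfolding f_def atLeastAtMost_iff by (subst if_P) linarith+
  moreover have "f x = p * x - p + 1" if "x \<in> {1-1/p..1}" for x
    using that ip unfolding f_def atLeastAtMost_iff by (subst if_not_P) linarith+
  ultimately show ?thesis using reg hullK unfolding P_def by blast
qed

end

theory Submission
  imports Defs
begin

text \<open>The halves of a bridge are its two bridges of the next generation. For two linked bridges of
  lengths \<open>a\<close> and \<open>b\<close>, halving the one whose central gap is shorter than the other bridge leaves
  a linked pair. With \<open>p = \<gamma>\<^sup>4\<^sup>0\<close> and \<open>q = \<gamma>\<^sup>3\<^sup>1\<close> the ratio \<open>b / a\<close> moves by the factors \<open>p\<close> and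
  \<open>1 / q\<close>, and this argument cannot be continued only if \<open>b / a\<close> lies between \<open>1.134\<close> and \<open>1.159\<close>
  and the position lies in a thin critical set. It takes a cycle of \<open>71\<close> halvings to return to
  this window, so the preimages of the critical set belong to different ratios. They can be avoided by
  choosing the other half, except where the choice is forced; this happens near the ends of the
  bridges, where the overlap stays constant. Excluding all positions of relative overlap
  below \<open>0.000104\<close> leaves \<open>15\<close> generations of preimages to avoid, with room in every inequality.

  For a perturbed Cantor set, the ratio of a half to its bridge differs from the affine value by a
  distortion factor. Its logarithm is bounded by a sum of terms \<open>min \<kappa> (M 2\<^bsup>-ke\<^esup>)\<close>, where
  \<open>\<kappa>\<close> is the oscillation of the derivative, and by \<open>min s t \<le> sqrt (s t)\<close> this sum tends to \<open>0\<close>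
  with \<open>\<kappa>\<close> although the Hoelder constant \<open>M\<close> does not.\<close>

section \<open>Positions of two bridges\<close>

text \<open>Let \<open>a\<close> and \<open>b\<close> be the lengths of a bridge \<open>[x, y]\<close> of the first set and a bridge
  \<open>[x', y']\<close> of the second one, and put \<open>e = y' - x\<close> and \<open>f = y - x'\<close>, so that
  \<open>e + f = a + b\<close>. Passing to the left half of \<open>[x, y]\<close> or the right half of \<open>[x', y']\<close>
  preserves \<open>e\<close>; the other two choices preserve \<open>f\<close>. If \<open>e\<close> is critical, the left half of the
  first bridge and the right half of the second one lie in the central gap of the other bridge,
  while the remaining halves may miss the other bridge; symmetrically for \<open>f\<close>. The exact bounds,
  for \<open>\<rho> = 1 / p\<close> and \<open>\<sigma> = 1 / q\<close>, are \<open>\<rho> a + \<sigma> b\<close>, \<open>(1 - \<rho>) a\<close> and \<open>(1 - \<sigma>) b\<close>.\<close>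

definition critical :: "real \<Rightarrow> real \<Rightarrow> real \<Rightarrow> bool" where
  "critical a b x \<longleftrightarrow> 0.28257 * a + 0.37544 * b < x \<and> x < 0.71751 * a \<and> x < 0.62456 * b"

text \<open>Positions that become critical after \<open>i\<close> halvings of the first and \<open>j\<close> halvings of the
  second bridge that preserve \<open>x\<close>. The intervals enclose \<open>1 / p\<close> and \<open>1 / q\<close> and leave room for
  perturbations.\<close>

definition hole :: "nat \<Rightarrow> nat \<Rightarrow> real \<Rightarrow> real \<Rightarrow> real \<Rightarrow> bool" where
  "hole i j a b x \<longleftrightarrow>
     (\<exists>\<alpha>\<in>{0.28257 ^ i * a..0.282574 ^ i * a}. \<exists>\<beta>\<in>{0.375511 ^ j * b..0.375515 ^ j * b}.
        critical \<alpha> \<beta> x \<or> critical \<alpha> \<beta> (\<alpha> + \<beta> - x))"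

text \<open>The order in which the bridges are halved is forced by the ratio \<open>b / a\<close>, so the index pairs
  form a chain. It may be cut after 16 pairs, as a hole with the next pair lies in the region
  \<open>x < 0.000104 (a + b)\<close> that is excluded anyway.\<close>

definition hole_indices :: "(nat \<times> nat) set" where
  "hole_indices = {(0,0), (0,1), (1,1), (1,2), (2,2), (2,3), (3,3), (3,4), (3,5), (4,5), (4,6),
     (5,6), (5,7), (6,7), (6,8), (6,9)}"

definition bad :: "real \<Rightarrow> real \<Rightarrow> real \<Rightarrow> bool" where
  "bad a b x \<longleftrightarrow> x < 0.000104 * (a + b) \<or> (\<exists>(i, j)\<in>hole_indices. hole i j a b x)"

section \<open>Holes under halving\<close>

lemma scaled_between:
  fixes l u c y z :: real
  assumes "y \<in> {l * z..u * z}" "c \<ge> 0"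
  shows "c * (l * z) \<le> c * y" "c * y \<le> c * (u * z)"
  using assms by (auto intro: mult_left_mono)

text \<open>The enclosure for i more halvings, started from a half, lies in the enclosure for i + 1
  halvings of the bridge itself. So the holes of a half pull back to holes of the bridge, with one
  index raised.\<close>

lemma hole_K:
  assumes "hole i j a' b x" "a' \<in> {0.28257 * a..0.282574 * a}"
  shows "hole (Suc i) j a b x"
proof -
  have "0.28257 ^ Suc i * a \<le> 0.28257 ^ i * a'" "0.282574 ^ i * a' \<le> 0.282574 ^ Suc i * a"
    using scaled_between[OF assms(2), of "0.28257 ^ i"] scaled_between[OF assms(2), of "0.282574 ^
        i"]
    by (simp_all only: power_Suc mult_ac) simp_all
  then have "{0.28257 ^ i * a'..0.282574 ^ i * a'} \<subseteq> {0.28257 ^ Suc i * a..0.282574 ^ Suc i * a}"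
    by (simp only: atLeastatMost_subset_iff) blast
  then show ?thesis using assms(1) unfolding hole_def by blast
qed

lemma hole_K':
  assumes "hole i j a b' x" "b' \<in> {0.375511 * b..0.375515 * b}"
  shows "hole i (Suc j) a b x"
proof -
  have "0.375511 ^ Suc j * b \<le> 0.375511 ^ j * b'" "0.375515 ^ j * b' \<le> 0.375515 ^ Suc j * b"
    using scaled_between[OF assms(2), of "0.375511 ^ j"] scaled_between[OF assms(2), of "0.375515 ^
        j"]
    by (simp_all only: power_Suc mult_ac) simp_all
  then have "{0.375511 ^ j * b'..0.375515 ^ j * b'} \<subseteq> {0.375511 ^ Suc j * b..0.375515 ^ Suc j * b}"
    by (simp only: atLeastatMost_subset_iff) blast
  then show ?thesis using assms(1) unfolding hole_def by blast
qed

text \<open>The inequalities of \<open>critical\<close> are compatible only for \<beta> / \<alpha>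
  in a short window, and they leave two narrow clusters for x / \<alpha>: the lower one if x itself
  is critical, the upper one if \<alpha> + \<beta> - x is.\<close>

lemma hole_bounds:
  assumes "hole i j a b x"
  obtains \<alpha> \<beta> where "0.28257 ^ i * a \<le> \<alpha>" "\<alpha> \<le> 0.282574 ^ i * a"
    "0.375511 ^ j * b \<le> \<beta>" "\<beta> \<le> 0.375515 ^ j * b"
    "0.7081 * \<alpha> < x" "x < 1.4503 * \<alpha>" "1.1342 * \<alpha> < \<beta>" "\<beta> < 1.1586 * \<alpha>"
    "x < 0.7176 * \<alpha> \<or> 1.4167 * \<alpha> < x"
proof -
  obtain \<alpha> \<beta> where *: "\<alpha> \<in> {0.28257 ^ i * a..0.282574 ^ i * a}"
      "\<beta> \<in> {0.375511 ^ j * b..0.375515 ^ j * b}"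
      "critical \<alpha> \<beta> x \<or> critical \<alpha> \<beta> (\<alpha> + \<beta> - x)"
    using assms unfolding hole_def by blast
  have "0.7081 * \<alpha> < x" "x < 1.4503 * \<alpha>" "1.1342 * \<alpha> < \<beta>" "\<beta> < 1.1586 * \<alpha>"
    "x < 0.7176 * \<alpha> \<or> 1.4167 * \<alpha> < x"
    using *(3) unfolding critical_def by auto
  with * show ?thesis using that unfolding atLeastAtMost_iff by blast
qed

section \<open>Numerical exclusion of holes\<close>

definition power_bounds :: "real list \<Rightarrow> real \<Rightarrow> real \<Rightarrow> real list \<Rightarrow> bool" where
  "power_bounds ls l u us \<longleftrightarrow> (\<forall>i<length ls. ls ! i \<le> l ^ i \<and> u ^ i \<le> us ! i)"

abbreviation "rho_lower \<equiv> [1, 0.28257, 0.0798458, 0.022562, 0.00637535, 0.00180148,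
     0.000509045, 0.00014384]"
abbreviation "rho_upper \<equiv> [1, 0.282574, 0.0798481, 0.022563, 0.00637572, 0.00180162,
     0.000509089, 0.000143856]"
abbreviation "sigma_lower \<equiv> [1, 0.375511, 0.141008, 0.0529502, 0.0198834, 0.00746643,
     0.00280372, 0.00105283, 0.000395349, 0.000148458, 0.0000557476]"
abbreviation "sigma_upper \<equiv> [1, 0.375515, 0.141012, 0.052952, 0.0198843, 0.00746684,
     0.00280391, 0.00105291, 0.000395384, 0.000148473, 0.0000557536]"

lemma rho_bounds: "power_bounds rho_lower 0.28257 0.282574 rho_upper"
  by (simp add: power_bounds_def All_less_Suc power_divide)

lemma sigma_bounds: "power_bounds sigma_lower 0.375511 0.375515 sigma_upper"
  by (simp add: power_bounds_def All_less_Suc power_divide)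

text \<open>With the powers replaced by decimals, each index pair becomes a problem of linear
  arithmetic. The ranges of i and j cover the chain and all pairs that leave it by one
  halving.\<close>

lemma hole_decimal_bounds:
  assumes "hole i j a b x" "i < 8" "j < 11" "a > 0" "b > 0"
  obtains \<alpha> \<beta> where "rho_lower ! i * a \<le> \<alpha>" "\<alpha> \<le> rho_upper ! i * a"
    "sigma_lower ! j * b \<le> \<beta>" "\<beta> \<le> sigma_upper ! j * b"
    "x < 1.4503 * \<alpha>" "1.1342 * \<alpha> < \<beta>" "\<beta> < 1.1586 * \<alpha>"
  using assms(1)
proof (cases rule: hole_bounds)
  case (1 \<alpha> \<beta>)
  have "rho_lower ! i * a \<le> 0.28257 ^ i * a" "0.282574 ^ i * a \<le> rho_upper ! i * a"
    using rho_bounds assms(2,4) unfolding power_bounds_def by (intro mult_right_mono; simp)+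
  moreover have "sigma_lower ! j * b \<le> 0.375511 ^ j * b" "0.375515 ^ j * b \<le> sigma_upper ! j * b"
    using sigma_bounds assms(3,5) unfolding power_bounds_def by (intro mult_right_mono; simp)+
  ultimately show ?thesis
    using 1 that[of \<alpha> \<beta>] by (meson order_trans)
qed

text \<open>A hole (i, j) forces b / a to be near 1.15 \<rho>^i / \<sigma>^j. This is below 0.4259
  for every listed pair but (7,9), the successor of the last pair of the chain. There b / a is near
  1.11, but x < 1.4503 \<alpha> falls below 0.000104 (a + b).\<close>

lemma not_hole_exit_K:
  assumes "(i, j) \<in> {(1,0), (2,1), (3,2), (4,3), (4,4), (5,5), (6,6), (7,7), (7,8), (7,9)}"
      "hole i j a b x"
    "a > 0" "0.4259 * a \<le> b" "b \<le> 1.1586 * a" "x \<ge> 0.000104 * (a + b)"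
  shows False
proof -
  have "b > 0" using assms(3-) by simp
  moreover have "i < 8 \<and> j < 11" using assms(1) by (elim insertE emptyE) simp_all
  ultimately obtain \<alpha> \<beta> where "rho_lower ! i * a \<le> \<alpha>" "\<alpha> \<le> rho_upper ! i * a"
      "sigma_lower ! j * b \<le> \<beta>" "\<beta> \<le> sigma_upper ! j * b"
      "x < 1.4503 * \<alpha>" "1.1342 * \<alpha> < \<beta>" "\<beta> < 1.1586 * \<alpha>"
    using hole_decimal_bounds assms(2,3) by blast
  then show False using assms(1,3-) unfolding insert_iff empty_iff prod.inject
    by (elim disjE conjE FalseE, simp_all only:, simp_all)
qed

text \<open>Each of these pairs would need b / a above 4.1003.\<close>

lemma not_hole_exit_K':
  assumes "(i, j) \<in> {(0,2), (1,3), (2,4), (3,6), (4,7), (5,8), (6,10)}" "hole i j a b x"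
    "a > 0" "1.1342 * a \<le> b" "b \<le> 4.1003 * a" "x \<ge> 0.000104 * (a + b)"
  shows False
proof -
  have "b > 0" using assms(3-) by simp
  moreover have "i < 8 \<and> j < 11" using assms(1) by (elim insertE emptyE) simp_all
  ultimately obtain \<alpha> \<beta> where "rho_lower ! i * a \<le> \<alpha>" "\<alpha> \<le> rho_upper ! i * a"
      "sigma_lower ! j * b \<le> \<beta>" "\<beta> \<le> sigma_upper ! j * b"
      "x < 1.4503 * \<alpha>" "1.1342 * \<alpha> < \<beta>" "\<beta> < 1.1586 * \<alpha>"
    using hole_decimal_bounds assms(2,3) by blast
  then show False using assms(1,3-) unfolding insert_iff empty_iff prod.inject
    by (elim disjE conjE FalseE, simp_all only:, simp_all)
qed

text \<open>The ratios required by these holes all miss the window. So while b / a is in the window,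
  a changed coordinate can only be bad by a small overlap.\<close>

lemma not_hole_between_K:
  assumes "(i, j) \<in> {(1,0), (1,1), (2,1), (2,2), (3,2), (3,3), (4,3), (4,4), (4,5), (5,5), (5,6),
      (6,6), (6,7), (7,7), (7,8), (7,9)}" "hole i j a b x" "a > 0" "1.1342 * a \<le> b"
      "b \<le> 1.1586 * a"
  shows False
proof -
  have "b > 0" using assms(3-) by simp
  moreover have "i < 8 \<and> j < 11" using assms(1) by (elim insertE emptyE) simp_all
  ultimately obtain \<alpha> \<beta> where "rho_lower ! i * a \<le> \<alpha>" "\<alpha> \<le> rho_upper ! i * a"
      "sigma_lower ! j * b \<le> \<beta>" "\<beta> \<le> sigma_upper ! j * b"
      "x < 1.4503 * \<alpha>" "1.1342 * \<alpha> < \<beta>" "\<beta> < 1.1586 * \<alpha>"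
    using hole_decimal_bounds assms(2,3) by blast
  then show False using assms(1,3-) unfolding insert_iff empty_iff prod.inject
    by (elim disjE conjE FalseE, simp_all only:, simp_all)
qed

lemma not_hole_between_K':
  assumes "(i, j) \<in> {(0,1), (0,2), (1,2), (1,3), (2,3), (2,4), (3,4), (3,5), (3,6), (4,6), (4,7),
      (5,7), (5,8), (6,8), (6,9), (6,10)}" "hole i j a b x" "a > 0" "1.1342 * a \<le> b"
      "b \<le> 1.1586 * a"
  shows False
proof -
  have "b > 0" using assms(3-) by simp
  moreover have "i < 8 \<and> j < 11" using assms(1) by (elim insertE emptyE) simp_all
  ultimately obtain \<alpha> \<beta> where "rho_lower ! i * a \<le> \<alpha>" "\<alpha> \<le> rho_upper ! i * a"
      "sigma_lower ! j * b \<le> \<beta>" "\<beta> \<le> sigma_upper ! j * b"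
      "x < 1.4503 * \<alpha>" "1.1342 * \<alpha> < \<beta>" "\<beta> < 1.1586 * \<alpha>"
    using hole_decimal_bounds assms(2,3) by blast
  then show False using assms(1,3-) unfolding insert_iff empty_iff prod.inject
    by (elim disjE conjE FalseE, simp_all only:, simp_all)
qed

text \<open>The two hulls have a ratio near 1. The closest ratio on the chain is that of (4,5),
  which stays below 0.99.\<close>

lemma not_hole_start:
  assumes "(i, j) \<in> {(0,0), (0,1), (1,1), (1,2), (2,2), (2,3), (3,3), (3,4), (3,5), (4,5), (4,6),
      (5,6), (5,7), (6,7), (6,8), (6,9)}" "hole i j a b x" "a > 0" "0.995 * a \<le> b" "b \<le> 1.005 * a"
  shows False
proof -
  have "b > 0" using assms(3-) by simp
  moreover have "i < 8 \<and> j < 11" using assms(1) by (elim insertE emptyE) simp_all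
  ultimately obtain \<alpha> \<beta> where "rho_lower ! i * a \<le> \<alpha>" "\<alpha> \<le> rho_upper ! i * a"
      "sigma_lower ! j * b \<le> \<beta>" "\<beta> \<le> sigma_upper ! j * b"
      "x < 1.4503 * \<alpha>" "1.1342 * \<alpha> < \<beta>" "\<beta> < 1.1586 * \<alpha>"
    using hole_decimal_bounds assms(2,3) by blast
  then show False using assms(1,3-) unfolding insert_iff empty_iff prod.inject
    by (elim disjE conjE FalseE, simp_all only:, simp_all)
qed

text \<open>The constants \<open>0.43486 = 1 - 2 * 0.28257\<close> and \<open>0.248978 = 1 - 2 * 0.375511\<close> bound the relative
  sizes of the central gaps. If \<open>x\<close> and \<open>y\<close> are the changed values of \<open>f\<close> and \<open>e\<close> for the two halves of
  a bridge, then \<open>x + y\<close> is the length of the other bridge minus the length of this gap.\<close>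

lemma small_hole_K:
  assumes "(i, j) \<in> {(2,1), (3,2), (4,3), (4,4), (4,5), (5,5), (5,6), (6,6), (6,7), (7,7), (7,8),
      (7,9)}" "hole i j a b x"
    "a > 0" "0.4259 * a \<le> b" "b \<le> 1.1342 * a"
  shows "2 * x < b - 0.43486 * a \<and> 0.0003 * (a + b) < b - 0.43486 * a \<and>
     b \<notin> {0.48 * a..0.495 * a} \<and> b \<notin> {0.64 * a..0.66 * a} \<and> b \<notin> {0.85 * a..0.875 * a}"
proof -
  have "b > 0" using assms(3-) by simp
  moreover have "i < 8 \<and> j < 11" using assms(1) by (elim insertE emptyE) simp_all
  ultimately obtain \<alpha> \<beta> where "rho_lower ! i * a \<le> \<alpha>" "\<alpha> \<le> rho_upper ! i * a"
      "sigma_lower ! j * b \<le> \<beta>" "\<beta> \<le> sigma_upper ! j * b"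
      "x < 1.4503 * \<alpha>" "1.1342 * \<alpha> < \<beta>" "\<beta> < 1.1586 * \<alpha>"
    using hole_decimal_bounds assms(2,3) by blast
  then show ?thesis using assms(1,3-) unfolding insert_iff empty_iff prod.inject
    by (elim disjE conjE FalseE, simp_all only:, simp_all)
qed

lemma small_hole_K':
  assumes "(i, j) \<in> {(0,2), (1,3), (2,3), (2,4), (3,4), (3,5), (3,6), (4,6), (4,7), (5,7), (5,8),
      (6,8), (6,9), (6,10)}" "hole i j a b x"
    "a > 0" "1.1586 * a \<le> b" "b \<le> 4.1003 * a"
  shows "2 * x < a - 0.248978 * b \<and> 0.0003 * (a + b) < a - 0.248978 * b \<and> b \<notin> {2.25 * a..2.35 * a}"
proof -
  have "b > 0" using assms(3-) by simp
  moreover have "i < 8 \<and> j < 11" using assms(1) by (elim insertE emptyE) simp_all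
  ultimately obtain \<alpha> \<beta> where "rho_lower ! i * a \<le> \<alpha>" "\<alpha> \<le> rho_upper ! i * a"
      "sigma_lower ! j * b \<le> \<beta>" "\<beta> \<le> sigma_upper ! j * b"
      "x < 1.4503 * \<alpha>" "1.1342 * \<alpha> < \<beta>" "\<beta> < 1.1586 * \<alpha>"
    using hole_decimal_bounds assms(2,3) by blast
  then show ?thesis using assms(1,3-) unfolding insert_iff empty_iff prod.inject
    by (elim disjE conjE FalseE, simp_all only:, simp_all)
qed

text \<open>These holes can exceed half of b - 0.43486 a, so comparing sizes does not exclude one in
  each half. Their ratio intervals are disjoint from each other and from those of the small holes,
  so two holes would have to be the same one. The bound on x rules out a big hole in one half
  together with a small overlap in the other.\<close>

lemma big_hole_K:
  assumes "(i, j) \<in> {(1,1), (2,2), (3,3)}" "hole i j a b x" "a > 0" "b > 0"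
  shows "(if i = 1 then b \<in> {0.85 * a..0.875 * a} else if i = 2 then b \<in> {0.64 * a..0.66 * a}
       else b \<in> {0.48 * a..0.495 * a}) \<and> x < b - 0.435 * a - 0.000104 * a - 0.000104 * b"
proof -
  have "b > 0" using assms(3-) by simp
  moreover have "i < 8 \<and> j < 11" using assms(1) by (elim insertE emptyE) simp_all
  ultimately obtain \<alpha> \<beta> where "rho_lower ! i * a \<le> \<alpha>" "\<alpha> \<le> rho_upper ! i * a"
      "sigma_lower ! j * b \<le> \<beta>" "\<beta> \<le> sigma_upper ! j * b"
      "x < 1.4503 * \<alpha>" "1.1342 * \<alpha> < \<beta>" "\<beta> < 1.1586 * \<alpha>"
    using hole_decimal_bounds assms(2,3) by blast
  then show ?thesis using assms(1,3-) unfolding insert_iff empty_iff prod.inject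
    by (elim disjE conjE FalseE, simp_all only:, simp_all)
qed

text \<open>The clusters of \<open>hole_bounds\<close> are too coarse here: a point of the lower and
  one of the upper cluster can add up to 2.15 \<alpha>, which (b - 0.43486 a) also attains at the
  lower end of its range. The inequalities tying x to \<beta> separate the two.\<close>

lemma big_holes_K_3:
  assumes "hole 3 3 a b x" "hole 3 3 a b y" "a > 0"
  shows "x + y \<notin> {b - 0.43486 * a..b - 0.434852 * a}"
  using assms unfolding hole_def critical_def
  by (elim disjE conjE bexE, simp_all add: power_divide)

text \<open>Two points of the clusters add up to about 1.42, 2.14 or 2.87 times \<alpha>. For i = 1
  the required sum is about 1.5 \<alpha>, for i = 2 about 2.7 \<alpha>, so it lies between these
  values.\<close>

lemma big_holes_K:
  assumes i: "i \<in> {1,2,3}" and x: "hole i i a b x" and y: "hole i i a b y" and "a > 0"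
  shows "x + y \<notin> {b - 0.43486 * a..b - 0.434852 * a}"
proof (cases "i = 3")
  case True
  then show ?thesis using big_holes_K_3 x y \<open>a > 0\<close> by blast
next
  case False
  then have "i = 1 \<or> i = 2" using i by blast
  from x show ?thesis
  proof (cases rule: hole_bounds)
    case x: (1 \<alpha> \<beta>)
    from y show ?thesis
    proof (cases rule: hole_bounds)
      case (1 \<alpha>' \<beta>')
      with x \<open>a > 0\<close> \<open>i = 1 \<or> i = 2\<close> show ?thesis
        by (elim disjE) (simp_all add: power_divide)
    qed
  qed
qed

lemma big_hole_K':
  assumes "hole 1 2 a b x" "a > 0" "b > 0"
  shows "b \<in> {2.25 * a..2.35 * a} \<and> x < a - 0.249 * b - 0.000104 * a - 0.000104 * b"
  using assms(1)
proof (cases rule: hole_bounds)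
  case (1 \<alpha> \<beta>)
  show ?thesis using assms(2-) 1(1-8) by (simp add: power_divide)
qed

lemma big_holes_K':
  assumes x: "hole 1 2 a b x" and y: "hole 1 2 a b y" and "a > 0"
  shows "x + y \<notin> {a - 0.248978 * b..a - 0.24897 * b}"
  using x
proof (cases rule: hole_bounds)
  case x: (1 \<alpha> \<beta>)
  show ?thesis using y
  proof (cases rule: hole_bounds)
    case (1 \<alpha>' \<beta>')
    with x \<open>a > 0\<close> show ?thesis
      by (elim disjE) (simp_all add: power_divide)
  qed
qed

text \<open>The last two conditions keep either bridge out of the central gap of the other one.\<close>

definition safe :: "real \<Rightarrow> real \<Rightarrow> real \<Rightarrow> real \<Rightarrow> bool" where
  "safe a b e f \<longleftrightarrow> 0 < a \<and> 0.4259 * a \<le> b \<and> b \<le> 4.1003 * a \<and> e + f = a + b \<and>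
     \<not> bad a b e \<and> \<not> bad a b f \<and> 0.71751 * a \<le> max e f \<and> 0.62456 * b \<le> max e f"

lemma safe_commute: "safe a b e f \<longleftrightarrow> safe a b f e"
  unfolding safe_def by (auto simp: max.commute add.commute)

section \<open>Halving one bridge of a linked pair\<close>

lemma hole_index_cases_K:
  assumes "(i, j) \<in> hole_indices"
  shows "(Suc i, j) \<in> hole_indices \<or>
    (Suc i, j) \<in> {(1,0), (2,1), (3,2), (4,3), (4,4), (5,5), (6,6), (7,7), (7,8), (7,9)}"
  using assms by (auto simp: hole_indices_def)

lemma hole_index_cases_K':
  assumes "(i, j) \<in> hole_indices"
  shows "(i, Suc j) \<in> hole_indices \<or> (i, Suc j) \<in> {(0,2), (1,3), (2,4), (3,6), (4,7), (5,8),
      (6,10)}"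
  using assms by (auto simp: hole_indices_def)

text \<open>The preserved coordinate stays good: a hole of the half pulls back either to the chain,
  where it is excluded by assumption, or to an exit pair, where none exists.\<close>

lemma not_bad_K:
  assumes nb: "\<not> bad a b x" and a': "a' \<in> {0.28257 * a..0.282574 * a}" and a: "a > 0"
    and s: "0.4259 * a \<le> b" "b \<le> 1.1586 * a"
  shows "\<not> bad a' b x"
proof
  assume bad: "bad a' b x"
  have x: "x \<ge> 0.000104 * (a + b)" using nb by (simp add: bad_def)
  have "a' \<le> a" using a' a by simp
  then have "\<not> x < 0.000104 * (a' + b)" using x by simp
  then obtain i j where ij: "(i, j) \<in> hole_indices" "hole i j a' b x"
    using bad by (auto simp: bad_def)
  then have h: "hole (Suc i) j a b x" using hole_K a' by blast
  with nb have "(Suc i, j) \<notin> hole_indices" by (auto simp: bad_def)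
  then show False using hole_index_cases_K[OF ij(1)] by (elim disjE notE
      not_hole_exit_K[OF _ h a s x])
qed

lemma not_bad_K':
  assumes nb: "\<not> bad a b x" and b': "b' \<in> {0.375511 * b..0.375515 * b}" and a: "a > 0"
    and s: "1.1342 * a \<le> b" "b \<le> 4.1003 * a"
  shows "\<not> bad a b' x"
proof
  assume bad: "bad a b' x"
  have x: "x \<ge> 0.000104 * (a + b)" using nb by (simp add: bad_def)
  have "b' \<le> b" using b' a s by simp
  then have "\<not> x < 0.000104 * (a + b')" using x by simp
  then obtain i j where ij: "(i, j) \<in> hole_indices" "hole i j a b' x"
    using bad by (auto simp: bad_def)
  then have h: "hole i (Suc j) a b x" using hole_K' b' by blast
  with nb have "(i, Suc j) \<notin> hole_indices" by (auto simp: bad_def)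
  then show False using hole_index_cases_K'[OF ij(1)] by (elim disjE notE
      not_hole_exit_K'[OF _ h a s x])
qed

lemma hole_00: "hole 0 0 a b x \<longleftrightarrow> critical a b x \<or> critical a b (a + b - x)"
  by (simp add: hole_def)

text \<open>Used for the changed coordinate x. The hole (0,0) is assumed away since it is symmetric
  in the two coordinates and would make the preserved one bad as well. The remaining cases are a
  small overlap, a small hole and a big hole, with the bounds needed to combine the cases of both
  halves.\<close>

lemma bad_child_cases_K:
  assumes bad: "bad a' b x" and a': "a' \<in> {0.28257 * a..0.282574 * a}" and a: "a > 0"
    and s: "0.4259 * a \<le> b" "b \<le> 1.1342 * a" and "\<not> hole 0 0 a' b x"
  obtains "x < 0.000104 * (0.282574 * a + b)"
  | "2 * x < b - 0.43486 * a" "0.0003 * (a + b) < b - 0.43486 * a"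
     "b \<notin> {0.48 * a..0.495 * a}" "b \<notin> {0.64 * a..0.66 * a}" "b \<notin> {0.85 * a..0.875 * a}"
  | i where "i \<in> {1,2,3::nat}" "hole i i a b x" "x < b - 0.435 * a - 0.000104 * a - 0.000104 * b"
     "if i = 1 then b \<in> {0.85 * a..0.875 * a} else if i = 2 then b \<in> {0.64 * a..0.66 * a}
       else b \<in> {0.48 * a..0.495 * a}"
proof (cases "x < 0.000104 * (a' + b)")
  case True
  then show ?thesis using that(1) a' by simp
next
  case False
  then obtain i j where ij: "(i, j) \<in> hole_indices" "hole i j a' b x"
    using bad by (auto simp: bad_def)
  then have h: "hole (Suc i) j a b x" using hole_K a' by blast
  have "(i, j) \<noteq> (0, 0)" using ij assms(6) by (metis prod.inject)
  then consider "(Suc i, j) \<in> {(1,1), (2,2), (3,3)}"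
    | "(Suc i, j) \<in> {(2,1), (3,2), (4,3), (4,4), (4,5), (5,5), (5,6), (6,6), (6,7), (7,7), (7,8),
        (7,9)}"
    using ij(1) unfolding hole_indices_def by (elim insertE) simp_all
  then show ?thesis
  proof cases
    case 1
    have "b > 0" using a s(1) by simp
    moreover have "j = Suc i" "Suc i \<in> {1,2,3}" using 1 by auto
    ultimately show ?thesis using big_hole_K[OF 1 h a] h that(3)[of "Suc i"] by blast
  next
    case 2
    show ?thesis using small_hole_K[OF 2 h a s] that(2) by blast
  qed
qed

lemma bad_child_cases_K':
  assumes bad: "bad a b' x" and b': "b' \<in> {0.375511 * b..0.375515 * b}" and a: "a > 0"
    and s: "1.1586 * a \<le> b" "b \<le> 4.1003 * a" and "\<not> hole 0 0 a b' x"
  obtains "x < 0.000104 * (a + 0.375515 * b)"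
  | "2 * x < a - 0.248978 * b" "0.0003 * (a + b) < a - 0.248978 * b" "b \<notin> {2.25 * a..2.35 * a}"
  | "hole 1 2 a b x" "x < a - 0.249 * b - 0.000104 * a - 0.000104 * b" "b \<in> {2.25 * a..2.35 * a}"
proof (cases "x < 0.000104 * (a + b')")
  case True
  then show ?thesis using that(1) b' by simp
next
  case False
  then obtain i j where ij: "(i, j) \<in> hole_indices" "hole i j a b' x"
    using bad by (auto simp: bad_def)
  then have h: "hole i (Suc j) a b x" using hole_K' b' by blast
  have "(i, j) \<noteq> (0, 0)" using ij assms(6) by (metis prod.inject)
  then consider "(i, Suc j) = (1,2)" | "(i, Suc j) \<in> {(0,2), (1,3), (2,3), (2,4), (3,4), (3,5),
      (3,6), (4,6), (4,7), (5,7), (5,8), (6,8), (6,9), (6,10)}"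
    using ij(1) unfolding hole_indices_def by (elim insertE) simp_all
  then show ?thesis
  proof cases
    case 1
    have "b > 0" using a s(1) by simp
    moreover have h: "hole 1 2 a b x" using 1 h by (simp add: numeral_2_eq_2)
    ultimately show ?thesis using big_hole_K'[OF h a] that(3) by blast
  next
    case 2
    show ?thesis using small_hole_K'[OF 2 h a s] that(2) by blast
  qed
qed

text \<open>The two changed coordinates add up to b minus the central gap of the first bridge. Two
  obstacles, one in each half, never have this sum: small ones are too short, a small and a big hole
  need different ratios, and two big ones are excluded by \<open>big_holes_K\<close>.\<close>

lemma not_both_bad_K:
  assumes "safe a b e f" and aL: "aL \<in> {0.28257 * a..0.282574 * a}"
    and aR: "aR \<in> {0.28257 * a..0.282574 * a}" and s: "b \<le> 1.1342 * a"
  shows "\<not> bad aL b (f - (a - aL)) \<or> \<not> bad aR b (e - (a - aR))"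
proof (rule ccontr)
  let ?x = "f - (a - aL)" and ?y = "e - (a - aR)"
  assume "\<not> ?thesis"
  then have bad: "bad aL b ?x" "bad aR b ?y" by auto
  have a: "a > 0" and s': "0.4259 * a \<le> b" "b \<le> 1.1586 * a" and sum: "e + f = a + b"
    and nb: "\<not> bad a b e" "\<not> bad a b f" and max: "0.71751 * a \<le> f \<or> 0.71751 * a \<le> e"
    using assms(1) s by (auto simp: safe_def max_def split: if_splits)
  have zero: "(0, 0) \<in> hole_indices" by (simp add: hole_indices_def)
  have "aL + b - ?x = e" "aR + b - ?y = f" using sum by auto
  then have "hole 0 0 aL b ?x \<longleftrightarrow> hole 0 0 aL b e" "hole 0 0 aR b ?y \<longleftrightarrow> hole 0 0 aR b f"
    unfolding hole_00 by (smt (verit))+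
  then have x0: "\<not> hole 0 0 aL b ?x" and y0: "\<not> hole 0 0 aR b ?y"
    using not_bad_K[OF nb(1) aL a s'] not_bad_K[OF nb(2) aR a s'] zero by (auto simp: bad_def)
  have xy: "b - 0.43486 * a \<le> ?x + ?y" "?x + ?y \<le> b - 0.434852 * a"
    using sum aL aR by simp_all
  show False
  proof (cases rule: bad_child_cases_K[OF bad(1) aL a s'(1) s x0])
    case x: 1
    show ?thesis
    proof (cases rule: bad_child_cases_K[OF bad(2) aR a s'(1) s y0])
      case 1
      \<comment> \<open>Two small overlaps force b to be about 0.435 a, so both coordinates are
        below 0.000075 a. But the condition on \<open>max\<close> leaves one of them at least
        0.71751 a - 0.71743 a = 0.00008 a. This bounds the threshold 0.000104 from above, as the
        pair (7,9) bounds it from below.\<close>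
      show ?thesis using max
      proof
        assume "0.71751 * a \<le> f"
        then show ?thesis using 1 x xy a s' aL aR by simp
      next
        assume "0.71751 * a \<le> e"
        then show ?thesis using 1 x xy a s' aL aR by simp
      qed
    next
      case 2
      show ?thesis using 2(1,2) x xy a s' by simp
    next
      case (3 i)
      show ?thesis using 3(3) x xy a s' by simp
    qed
  next
    case x: 2
    show ?thesis
    proof (cases rule: bad_child_cases_K[OF bad(2) aR a s'(1) s y0])
      case 1
      show ?thesis using 1 x(1,2) xy a s' by simp
    next
      case 2
      show ?thesis using 2(1) x(1) xy by simp
    next
      case (3 i)
      show ?thesis using 3(4) x(3-5) by (simp split: if_splits)
    qed
  next
    case x: (3 i)
    show ?thesis
    proof (cases rule: bad_child_cases_K[OF bad(2) aR a s'(1) s y0])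
      case 1
      show ?thesis using 1 x(3) xy a s' by simp
    next
      case 2
      show ?thesis using 2 x by (auto split: if_splits)
    next
      case y: (3 k)
      have "i = k" using x(1,4) y(1,4) a by (elim insertE emptyE) simp_all
      then have "?x + ?y \<notin> {b - 0.43486 * a..b - 0.434852 * a}"
        using big_holes_K[OF x(1,2) _ a] y(2) by blast
      then show ?thesis using xy unfolding atLeastAtMost_iff by blast
    qed
  qed
qed

lemma not_both_bad_K':
  assumes "safe a b e f" and bR: "bR \<in> {0.375511 * b..0.375515 * b}"
    and bL: "bL \<in> {0.375511 * b..0.375515 * b}" and s: "1.1586 * a \<le> b"
  shows "\<not> bad a bR (f - (b - bR)) \<or> \<not> bad a bL (e - (b - bL))"
proof (rule ccontr)
  let ?x = "f - (b - bR)" and ?y = "e - (b - bL)"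
  assume "\<not> ?thesis"
  then have bad: "bad a bR ?x" "bad a bL ?y" by auto
  have a: "a > 0" and s': "1.1342 * a \<le> b" "b \<le> 4.1003 * a" and sum: "e + f = a + b"
    and nb: "\<not> bad a b e" "\<not> bad a b f" and max: "0.62456 * b \<le> f \<or> 0.62456 * b \<le> e"
    using assms(1) s by (auto simp: safe_def max_def split: if_splits)
  have zero: "(0, 0) \<in> hole_indices" by (simp add: hole_indices_def)
  have "a + bR - ?x = e" "a + bL - ?y = f" using sum by auto
  then have "hole 0 0 a bR ?x \<longleftrightarrow> hole 0 0 a bR e" "hole 0 0 a bL ?y \<longleftrightarrow> hole 0 0 a bL f"
    unfolding hole_00 by (smt (verit))+
  then have x0: "\<not> hole 0 0 a bR ?x" and y0: "\<not> hole 0 0 a bL ?y"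
    using not_bad_K'[OF nb(1) bR a s'] not_bad_K'[OF nb(2) bL a s'] zero by (auto simp: bad_def)
  have xy: "a - 0.248978 * b \<le> ?x + ?y" "?x + ?y \<le> a - 0.24897 * b"
    using sum bL bR by simp_all
  show False
  proof (cases rule: bad_child_cases_K'[OF bad(1) bR a s s'(2) x0])
    case x: 1
    show ?thesis
    proof (cases rule: bad_child_cases_K'[OF bad(2) bL a s s'(2) y0])
      case 1
      \<comment> \<open>Now a is about 0.249 b, the coordinates are below 0.000066 b, and one of
        them is at least 0.62456 b - 0.624489 b = 0.000071 b.\<close>
      show ?thesis using max
      proof
        assume "0.62456 * b \<le> f"
        then show ?thesis using 1 x xy a s' bL bR by simp
      next
        assume "0.62456 * b \<le> e"
        then show ?thesis using 1 x xy a s' bL bR by simp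
      qed
    next
      case 2
      show ?thesis using 2(1,2) x xy a s' by simp
    next
      case 3
      show ?thesis using 3(2) x xy a s' by simp
    qed
  next
    case x: 2
    show ?thesis
    proof (cases rule: bad_child_cases_K'[OF bad(2) bL a s s'(2) y0])
      case 1
      show ?thesis using 1 x(1,2) xy a s' by simp
    next
      case 2
      show ?thesis using 2(1) x(1) xy by simp
    next
      case 3
      show ?thesis using 3(3) x(3) by simp
    qed
  next
    case x: 3
    show ?thesis
    proof (cases rule: bad_child_cases_K'[OF bad(2) bL a s s'(2) y0])
      case 1
      show ?thesis using 1 x(2) xy a s' by simp
    next
      case 2
      show ?thesis using 2 x by auto
    next
      case 3
      show ?thesis using big_holes_K'[OF x(1) 3(1) a] xy by auto
    qed
  qed
qed

text \<open>Outside the window the conditions on \<open>max\<close> hold automatically, since the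
  larger coordinate is at least half of aL + b. For b \<le> 1.1342 a this is at least 0.62456 b, as
  0.28257 / 1.1342 \<ge> 0.24912; this explains the lower end of the window.\<close>

lemma safe_K:
  assumes "safe a b e f" and aL: "aL \<in> {0.28257 * a..0.282574 * a}"
    and s: "b \<le> 1.1342 * a" and nb: "\<not> bad aL b (f - (a - aL))"
  shows "safe aL b e (f - (a - aL))"
proof -
  have a: "a > 0" and s': "0.4259 * a \<le> b" "b \<le> 1.1586 * a" and sum: "e + f = a + b"
    and nb': "\<not> bad a b e"
    using assms(1) s by (auto simp: safe_def)
  have "2 * max e (f - (a - aL)) \<ge> aL + b" using sum by (auto simp: max_def)
  then show ?thesis
    using nb not_bad_K[OF nb' aL a s'] a s s' aL sum unfolding safe_def by auto
qed

lemma safe_K':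
  assumes "safe a b e f" and bR: "bR \<in> {0.375511 * b..0.375515 * b}"
    and s: "1.1586 * a \<le> b" and nb: "\<not> bad a bR (f - (b - bR))"
  shows "safe a bR e (f - (b - bR))"
proof -
  have a: "a > 0" and s': "1.1342 * a \<le> b" "b \<le> 4.1003 * a" and sum: "e + f = a + b"
    and nb': "\<not> bad a b e"
    using assms(1) s by (auto simp: safe_def)
  \<comment> \<open>The upper end of the window comes from here: 0.375511 * 1.1586 \<ge> 0.43502 = 2
    * 0.71751 - 1.\<close>
  have "2 * max e (f - (b - bR)) \<ge> a + bR" using sum by (auto simp: max_def)
  then show ?thesis
    using nb not_bad_K'[OF nb' bR a s'] a s s' bR sum unfolding safe_def by auto
qed

text \<open>Only the conditions on \<open>max\<close> can fail in the window. The smaller coordinate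
  e is kept, and the set to be halved is the one for which e, or else the reduced f, is still large
  enough. The choice is expressed by e alone, so that it does not depend on the lengths of the
  halves.\<close>

lemma safe_between:
  assumes "safe a b e f" and aL: "aL \<in> {0.28257 * a..0.282574 * a}"
    and bR: "bR \<in> {0.375511 * b..0.375515 * b}"
    and s: "1.1342 * a \<le> b" "b \<le> 1.1586 * a" and ef: "e \<le> f"
  shows "(e \<ge> 0.62456 * b \<or> e < 0.71751 * a) \<and> safe aL b e (f - (a - aL)) \<or>
    (e < 0.62456 * b \<and> e \<ge> 0.71751 * a) \<and> safe a bR e (f - (b - bR))"
proof -
  have a: "a > 0" and s': "0.4259 * a \<le> b" "b \<le> 4.1003 * a" and sum: "e + f = a + b"
    and nb: "\<not> bad a b e"
    using assms(1) s by (auto simp: safe_def)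
  have "bad a b e" if "critical a b e"
    unfolding bad_def using that hole_00[of a b e] by (auto simp: hole_indices_def)
  then have crit: "\<not> critical a b e" using nb by blast
  have nbL: "\<not> bad aL b x" if x: "x \<ge> 0.000104 * (aL + b)" for x
  proof
    assume bad: "bad aL b x"
    then obtain i j where ij: "(i, j) \<in> hole_indices" "hole i j aL b x"
      using bad x by (auto simp: bad_def)
    then have h: "hole (Suc i) j a b x" using hole_K aL by blast
    have "(Suc i, j) \<in> {(1,0), (1,1), (2,1), (2,2), (3,2), (3,3), (4,3), (4,4), (4,5), (5,5),
        (5,6), (6,6), (6,7), (7,7), (7,8), (7,9)}" using ij(1) unfolding hole_indices_def by (elim
        insertE) simp_all
    then show False by (rule not_hole_between_K[OF _ h a s])
  qed
  have nbR: "\<not> bad a bR x" if x: "x \<ge> 0.000104 * (a + bR)" for x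
  proof
    assume bad: "bad a bR x"
    then obtain i j where ij: "(i, j) \<in> hole_indices" "hole i j a bR x"
      using bad x by (auto simp: bad_def)
    then have h: "hole i (Suc j) a b x" using hole_K' bR by blast
    have "(i, Suc j) \<in> {(0,1), (0,2), (1,2), (1,3), (2,3), (2,4), (3,4), (3,5), (3,6), (4,6),
        (4,7), (5,7), (5,8), (6,8), (6,9), (6,10)}" using ij(1) unfolding hole_indices_def by (elim
        insertE) simp_all
    then show False by (rule not_hole_between_K'[OF _ h a s])
  qed
  have e: "\<not> bad aL b e" "\<not> bad a bR e"
    using not_bad_K[OF nb aL a s'(1) s(2)] not_bad_K'[OF nb bR a s(1) s'(2)] by auto
  consider "e \<ge> 0.62456 * b" | "e < 0.62456 * b" "e \<ge> 0.71751 * a"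
    | "e < 0.62456 * b" "e < 0.71751 * a" by linarith
  then show ?thesis
  proof cases
    case 1
    have "safe aL b e (f - (a - aL))"
      unfolding safe_def using e nbL[of "f - (a - aL)"] 1 a s s' aL sum ef by (auto simp:
          le_max_iff_disj)
    then show ?thesis using 1 by blast
  next
    case 2
    have "safe a bR e (f - (b - bR))"
      unfolding safe_def using e nbR[of "f - (b - bR)"] 2 a s s' bR sum ef by (auto simp:
          le_max_iff_disj)
    then show ?thesis using 2 by blast
  next
    case 3
    \<comment> \<open>As e is not critical, e \<le> 0.28257 a + 0.37544 b. So f is large enough to
      remain at least 0.62456 b after losing a - aL.\<close>
    then have "0.71743 * a + 0.62456 * b \<le> f" using crit sum by (auto simp: critical_def)
    then have "safe aL b e (f - (a - aL))"
      unfolding safe_def using e nbL[of "f - (a - aL)"] a s s' aL sum by (auto simp: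
          le_max_iff_disj)
    then show ?thesis using 3 by blast
  qed
qed

text \<open>The set to be halved is determined by a, b, e and f, while the half to be kept may
  depend on the actual lengths, which differ between the two halves of a perturbed bridge.\<close>

lemma safe_step:
  assumes safe: "safe a b e f"
  shows "(\<forall>aL\<in>{0.28257 * a..0.282574 * a}. \<forall>aR\<in>{0.28257 * a..0.282574 * a}.
        safe aL b e (f - (a - aL)) \<or> safe aR b (e - (a - aR)) f) \<or>
      (\<forall>bL\<in>{0.375511 * b..0.375515 * b}. \<forall>bR\<in>{0.375511 * b..0.375515 * b}.
        safe a bR e (f - (b - bR)) \<or> safe a bL (e - (b - bL)) f)"
proof -
  have safe': "safe a b f e" using safe safe_commute by blast
  consider "b \<le> 1.1342 * a" | "1.1586 * a \<le> b" | "1.1342 * a \<le> b" "b \<le> 1.1586 * a" by linarith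
  then show ?thesis
  proof cases
    case 1
    show ?thesis using safe_K[OF safe _ 1] safe_K[OF safe' _ 1] not_both_bad_K[OF safe _ _ 1]
        safe_commute
      by meson
  next
    case 2
    show ?thesis
      using safe_K'[OF safe _ 2] safe_K'[OF safe' _ 2] not_both_bad_K'[OF safe _ _ 2] safe_commute
      by meson
  next
    case 3
    show ?thesis
    proof (cases "e \<le> f")
      case True
      show ?thesis using safe_between[OF safe _ _ 3 True] by (meson not_le)
    next
      case False
      then have "f \<le> e" by simp
      show ?thesis using safe_between[OF safe' _ _ 3 \<open>f \<le> e\<close>] safe_commute by (meson not_le)
    qed
  qed
qed

lemma safe_start:
  assumes "a \<in> {0.999..1.001}" "b \<in> {0.999..1.001}" "e \<in> {0.999..1.001}" "e + f = a + b"
  shows "safe a b e f"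
proof -
  have a: "a > 0" "0.995 * a \<le> b" "b \<le> 1.005 * a" using assms by simp_all
  then have hole: "\<not> hole i j a b x" if "(i, j) \<in> hole_indices" for i j x
    using not_hole_start[OF that[unfolded hole_indices_def]] by blast
  have nb: "\<not> bad a b x" if "x \<ge> 0.99" for x
  proof -
    have "\<not> x < 0.000104 * (a + b)" using that assms by simp
    then show ?thesis using hole unfolding bad_def by blast
  qed
  have f: "f \<ge> 0.99" and e: "e \<ge> 0.99" using assms by simp_all
  then show ?thesis unfolding safe_def using nb[OF f] nb[OF e] a assms by (simp add:
      le_max_iff_disj)
qed

section \<open>Recursive choice of linked bridges\<close>

text \<open>The recursion uses only closure under halving with controlled proportions and a point of
  the Cantor set in every bridge; the dynamics does not enter.\<close>

definition bridge_family :: "real \<Rightarrow> real \<Rightarrow> real set \<Rightarrow> (real \<times> real) set \<Rightarrow> bool" where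
  "bridge_family r s L \<B> \<longleftrightarrow> (\<forall>(x, y)\<in>\<B>. x < y \<and> L \<inter> {x..y} \<noteq> {} \<and>
     (\<exists>u v. (x, u) \<in> \<B> \<and> (v, y) \<in> \<B> \<and> u - x \<in> {r * (y - x)..s * (y - x)} \<and>
        y - v \<in> {r * (y - x)..s * (y - x)}))"

text \<open>The factor 0.9 is available because b / a stays between 0.4259 and 4.1003: either kind
  of halving removes more than a tenth of the total length.\<close>

lemma safe_refine:
  assumes L: "bridge_family 0.28257 0.282574 L \<B>" and L': "bridge_family 0.375511 0.375515 L' \<B>'"
    and B: "(x, y) \<in> \<B>" "(x', y') \<in> \<B>'" and safe: "safe (y - x) (y' - x') (y' - x) (y - x')"
  shows "\<exists>v w v' w'. (v, w) \<in> \<B> \<and> (v', w') \<in> \<B>' \<and> safe (w - v) (w' - v') (w' - v) (w - v') \<and>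
    w - v + (w' - v') \<le> 0.9 * (y - x + (y' - x'))"
proof -
  obtain u v where uv: "(x, u) \<in> \<B>" "(v, y) \<in> \<B>"
      "u - x \<in> {0.28257 * (y - x)..0.282574 * (y - x)}"
      "y - v \<in> {0.28257 * (y - x)..0.282574 * (y - x)}"
    using L B(1) unfolding bridge_family_def by blast
  obtain u' v' where uv': "(x', u') \<in> \<B>'" "(v', y') \<in> \<B>'"
      "u' - x' \<in> {0.375511 * (y' - x')..0.375515 * (y' - x')}"
      "y' - v' \<in> {0.375511 * (y' - x')..0.375515 * (y' - x')}"
    using L' B(2) unfolding bridge_family_def by blast
  have range: "0 < y - x" "0.4259 * (y - x) \<le> y' - x'" "y' - x' \<le> 4.1003 * (y - x)"
    using safe by (auto simp: safe_def)
  have eqs: "y - x' - (y - x - (u - x)) = u - x'" "y' - x - (y - x - (y - v)) = y' - v"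
    "y - x' - (y' - x' - (y' - v')) = y - v'" "y' - x - (y' - x' - (u' - x')) = u' - x" by simp_all
  consider "safe (u - x) (y' - x') (y' - x) (u - x')" | "safe (y - v) (y' - x') (y' - v) (y - x')"
    | "safe (y - x) (y' - v') (y' - x) (y - v')" | "safe (y - x) (u' - x') (u' - x) (y - x')"
    using safe_step[OF safe] uv(3,4) uv'(3,4) unfolding eqs[symmetric] by blast
  then show ?thesis
  proof cases
    case 1
    have "u - x + (y' - x') \<le> 0.9 * (y - x + (y' - x'))"
      using range uv(3,4) uv'(3,4) by simp
    then show ?thesis using 1 uv(1) B(2) by blast
  next
    case 2
    have "y - v + (y' - x') \<le> 0.9 * (y - x + (y' - x'))"
      using range uv(3,4) uv'(3,4) by simp
    then show ?thesis using 2 uv(2) B(2) by blast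
  next
    case 3
    have "y - x + (y' - v') \<le> 0.9 * (y - x + (y' - x'))"
      using range uv(3,4) uv'(3,4) by simp
    then show ?thesis using 3 B(1) uv'(2) by blast
  next
    case 4
    have "y - x + (u' - x') \<le> 0.9 * (y - x + (y' - x'))"
      using range uv(3,4) uv'(3,4) by simp
    then show ?thesis using 4 B(1) uv'(1) by blast
  qed
qed

text \<open>Disjoint compact sets have a positive distance d. Safe pairs are linked, as small and
  negative overlaps are bad, so a safe pair of total length below d contains points of both sets
  closer than d.\<close>

lemma safe_bridges_intersect:
  assumes L: "bridge_family 0.28257 0.282574 L \<B>" and L': "bridge_family 0.375511 0.375515 L' \<B>'"
    and B: "(x, y) \<in> \<B>" "(x', y') \<in> \<B>'" and safe: "safe (y - x) (y' - x') (y' - x) (y - x')"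
    and "compact L" "compact L'"
  shows "L \<inter> L' \<noteq> {}"
proof
  assume "L \<inter> L' = {}"
  then obtain d where d: "d > 0" "\<And>z z'. z \<in> L \<Longrightarrow> z' \<in> L' \<Longrightarrow> d \<le> dist z z'"
    using separate_compact_closed[of L L'] \<open>compact L\<close> \<open>compact L'\<close> compact_imp_closed by blast
  have *: "\<exists>v w v' w'. (v, w) \<in> \<B> \<and> (v', w') \<in> \<B>' \<and> safe (w - v) (w' - v') (w' - v) (w - v') \<and>
    w - v + (w' - v') \<le> 0.9 ^ n * (y - x + (y' - x'))" for n
  proof (induction n)
    case 0
    show ?case using B safe by (intro exI[of _ x] exI[of _ y] exI[of _ x'] exI[of _ y']) simp
  next
    case (Suc n)
    then obtain v w v' w' where n: "(v, w) \<in> \<B>" "(v', w') \<in> \<B>'"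
        "safe (w - v) (w' - v') (w' - v) (w - v')"
        "w - v + (w' - v') \<le> 0.9 ^ n * (y - x + (y' - x'))" by blast
    obtain s t s' t' where "(s, t) \<in> \<B>" "(s', t') \<in> \<B>'" "safe (t - s) (t' - s') (t' - s) (t - s')"
        and le: "t - s + (t' - s') \<le> 0.9 * (w - v + (w' - v'))"
      using safe_refine[OF L L' n(1-3)] by blast
    moreover have "0.9 * (w - v + (w' - v')) \<le> 0.9 ^ Suc n * (y - x + (y' - x'))"
      using mult_left_mono[OF n(4), of "0.9"] by (simp add: mult.assoc)
    ultimately show ?case using order_trans[OF le] by blast
  qed
  have "y - x + (y' - x') > 0" using safe by (simp add: safe_def)
  then obtain n where n: "0.9 ^ n < d / (y - x + (y' - x'))"
    using real_arch_pow_inv[of "d / (y - x + (y' - x'))" "0.9"] d(1) by auto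
  obtain v w v' w' where vw: "(v, w) \<in> \<B>" "(v', w') \<in> \<B>'" "safe (w - v) (w' - v') (w' - v) (w - v')"
      "w - v + (w' - v') \<le> 0.9 ^ n * (y - x + (y' - x'))" using *[of n] by blast
  then have small: "w - v + (w' - v') < d"
    using n \<open>y - x + (y' - x') > 0\<close> by (simp add: pos_less_divide_eq)
  obtain z where z: "z \<in> L" "v \<le> z" "z \<le> w" using L vw(1) unfolding bridge_family_def by fastforce
  obtain z' where z': "z' \<in> L'" "v' \<le> z'" "z' \<le> w'" using L' vw(2) unfolding bridge_family_def by
      fastforce
  have nb: "\<not> w' - v < 0.000104 * (w - v + (w' - v'))" "\<not> w - v' < 0.000104 * (w - v + (w' - v'))"
    and "w > v" "w' > v'"
    using vw(3) by (auto simp: safe_def bad_def)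
  then have "w' \<ge> v" "w \<ge> v'" by simp_all
  then have "dist z z' \<le> w - v + (w' - v')" using z z' by (simp add: dist_real_def abs_le_iff)
  then show False using d(2)[OF z(1) z'(1)] small by simp
qed

section \<open>Bounded distortion\<close>

locale two_branch_map =
  fixes \<eta> \<eta>' :: "real \<Rightarrow> real" and a\<^sub>0 b\<^sub>0 a\<^sub>1 b\<^sub>1 \<kappa> M e :: real
  assumes order: "a\<^sub>0 < b\<^sub>0" "b\<^sub>0 < a\<^sub>1" "a\<^sub>1 < b\<^sub>1" "b\<^sub>1 - a\<^sub>0 \<le> 2"
    and derivative: "\<And>z. z \<in> {a\<^sub>0..b\<^sub>0} \<union> {a\<^sub>1..b\<^sub>1} \<Longrightarrow> (\<eta> has_real_derivative \<eta>' z) (at z)"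
    and expanding: "\<And>z. z \<in> {a\<^sub>0..b\<^sub>0} \<union> {a\<^sub>1..b\<^sub>1} \<Longrightarrow> 2 \<le> \<eta>' z"
    and oscillation:
        "\<And>z w. z \<in> {a\<^sub>0..b\<^sub>0} \<union> {a\<^sub>1..b\<^sub>1} \<Longrightarrow> w \<in> {a\<^sub>0..b\<^sub>0} \<union> {a\<^sub>1..b\<^sub>1} \<Longrightarrow> \<bar>\<eta>' z - \<eta>' w\<bar> \<le> \<kappa>"
    and hoelder:
        "\<And>z w I. I \<in> {{a\<^sub>0..b\<^sub>0}, {a\<^sub>1..b\<^sub>1}} \<Longrightarrow> z \<in> I \<Longrightarrow> w \<in> I \<Longrightarrow> \<bar>\<eta>' z - \<eta>' w\<bar> \<le> M * \<bar>z - w\<bar> powr e"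
    and M: "M \<ge> 0" and e: "e > 0"
    and endpoints: "\<eta> a\<^sub>0 = a\<^sub>0" "\<eta> b\<^sub>0 = b\<^sub>1" "\<eta> a\<^sub>1 = a\<^sub>0" "\<eta> b\<^sub>1 = b\<^sub>1"
begin

definition S :: "real set" where "S = {a\<^sub>0..b\<^sub>0} \<union> {a\<^sub>1..b\<^sub>1}"

definition bridge :: "nat \<Rightarrow> real \<Rightarrow> real \<Rightarrow> bool" where
  "bridge n x y \<longleftrightarrow> x < y \<and> (\<forall>k<n. \<exists>I\<in>{{a\<^sub>0..b\<^sub>0}, {a\<^sub>1..b\<^sub>1}}. (\<eta> ^^ k) ` {x..y} \<subseteq> I) \<and>
     (\<eta> ^^ n) x = a\<^sub>0 \<and> (\<eta> ^^ n) y = b\<^sub>1"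

lemma kappa_nonneg: "\<kappa> \<ge> 0"
  using oscillation[of a\<^sub>0 a\<^sub>0] order by auto

lemma derivative_funpow:
  assumes "\<forall>k<n. (\<eta> ^^ k) z \<in> S"
  shows "((\<eta> ^^ n) has_real_derivative (\<Prod>k<n. \<eta>' ((\<eta> ^^ k) z))) (at z)"
  using assms
proof (induction n)
  case 0
  show ?case by (simp add: id_def)
next
  case (Suc n)
  have "(\<eta> has_real_derivative \<eta>' ((\<eta> ^^ n) z)) (at ((\<eta> ^^ n) z))"
    using derivative Suc.prems by (simp add: S_def)
  moreover have "((\<eta> ^^ n) has_real_derivative (\<Prod>k<n. \<eta>' ((\<eta> ^^ k) z))) (at z)"
    using Suc by simp
  ultimately have "((\<eta> \<circ> (\<eta> ^^ n)) has_real_derivative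
      \<eta>' ((\<eta> ^^ n) z) * (\<Prod>k<n. \<eta>' ((\<eta> ^^ k) z))) (at z)"
    by (rule DERIV_chain)
  then show ?case by (simp add: comp_def mult.commute)
qed

lemma expansion:
  assumes "I \<in> {{a\<^sub>0..b\<^sub>0}, {a\<^sub>1..b\<^sub>1}}" "z \<in> I" "w \<in> I"
  shows "2 * \<bar>z - w\<bar> \<le> \<bar>\<eta> z - \<eta> w\<bar>"
proof -
  have *: "2 * (w - z) \<le> \<eta> w - \<eta> z" if "z < w" "z \<in> I" "w \<in> I" for z w
  proof -
    have S: "t \<in> {a\<^sub>0..b\<^sub>0} \<union> {a\<^sub>1..b\<^sub>1}" if "z \<le> t" "t \<le> w" for t
      using that \<open>z \<in> I\<close> \<open>w \<in> I\<close> assms(1) by auto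
    obtain t where t: "z < t" "t < w" "\<eta> w - \<eta> z = (w - z) * \<eta>' t"
      using MVT2[OF \<open>z < w\<close>] derivative S by blast
    have "(w - z) * 2 \<le> (w - z) * \<eta>' t"
      using expanding[OF S[of t]] t that by (intro mult_left_mono) auto
    then show ?thesis using t by simp
  qed
  show ?thesis using *[of z w] *[of w z] assms(2,3) by (cases z w rule: linorder_cases) auto
qed

lemma backward_contraction:
  assumes "bridge n x y" "z \<in> {x..y}" "w \<in> {x..y}" "k + m = n"
  shows "2 ^ m * \<bar>(\<eta> ^^ k) z - (\<eta> ^^ k) w\<bar> \<le> \<bar>(\<eta> ^^ n) z - (\<eta> ^^ n) w\<bar>"
  using assms(4)
proof (induction m arbitrary: k)
  case 0
  then show ?case by simp
next
  case (Suc m)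
  then have "k < n" by simp
  then obtain I where "I \<in> {{a\<^sub>0..b\<^sub>0}, {a\<^sub>1..b\<^sub>1}}" "(\<eta> ^^ k) ` {x..y} \<subseteq> I"
    using assms(1) unfolding bridge_def by blast
  moreover from this(2) have "(\<eta> ^^ k) z \<in> I" "(\<eta> ^^ k) w \<in> I" using assms(2,3) by blast+
  ultimately have "2 * \<bar>(\<eta> ^^ k) z - (\<eta> ^^ k) w\<bar> \<le> \<bar>(\<eta> ^^ Suc k) z - (\<eta> ^^ Suc k) w\<bar>"
    using expansion[of I "(\<eta> ^^ k) z" "(\<eta> ^^ k) w"] by simp
  then have "2 ^ m * (2 * \<bar>(\<eta> ^^ k) z - (\<eta> ^^ k) w\<bar>) \<le> 2 ^ m * \<bar>(\<eta> ^^ Suc k) z - (\<eta> ^^ Suc k) w\<bar>"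
    by (intro mult_left_mono) auto
  also have "\<dots> \<le> \<bar>(\<eta> ^^ n) z - (\<eta> ^^ n) w\<bar>" using Suc.IH[of "Suc k"] Suc.prems by simp
  finally show ?case by (simp add: mult_ac)
qed

definition D :: "nat \<Rightarrow> real \<Rightarrow> real" where "D n z = (\<Prod>k<n. \<eta>' ((\<eta> ^^ k) z))"

lemma bridge_orbit: "bridge n x y \<Longrightarrow> z \<in> {x..y} \<Longrightarrow> k < n \<Longrightarrow> (\<eta> ^^ k) z \<in> S"
  unfolding bridge_def S_def by blast

lemma bridge_derivative:
  assumes "bridge n x y" "z \<in> {x..y}"
  shows "((\<eta> ^^ n) has_real_derivative D n z) (at z)" "D n z > 0"
proof -
  show "((\<eta> ^^ n) has_real_derivative D n z) (at z)"
    unfolding D_def using bridge_orbit[OF assms] by (intro derivative_funpow) blast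
  have "\<eta>' ((\<eta> ^^ k) z) > 0" if "k < n" for k
    using expanding[of "(\<eta> ^^ k) z"] bridge_orbit[OF assms that] by (simp add: S_def)
  then show "D n z > 0" unfolding D_def by (intro prod_pos) auto
qed

lemma bridge_strict_mono:
  assumes "bridge n x y" "x \<le> z" "z < w" "w \<le> y"
  shows "(\<eta> ^^ n) z < (\<eta> ^^ n) w"
proof (rule DERIV_pos_imp_increasing[OF \<open>z < w\<close>])
  fix t assume "z \<le> t" "t \<le> w"
  then show "\<exists>d. ((\<eta> ^^ n) has_real_derivative d) (at t) \<and> 0 < d"
    using bridge_derivative[OF assms(1), of t] assms by auto
qed

lemma bridge_range:
  assumes "bridge n x y" "z \<in> {x..y}"
  shows "(\<eta> ^^ n) z \<in> {a\<^sub>0..b\<^sub>1}"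
proof -
  have "(\<eta> ^^ n) x \<le> (\<eta> ^^ n) z" "(\<eta> ^^ n) z \<le> (\<eta> ^^ n) y"
    using bridge_strict_mono[OF assms(1), of x z] bridge_strict_mono[OF assms(1), of z y] assms(2)
    by (cases "x = z"; force) (use bridge_strict_mono[OF assms(1), of z y] assms(2) in \<open>cases "z =
        y"; force\<close>)
  then show ?thesis using assms(1) by (simp add: bridge_def)
qed

definition T :: real where "T = sqrt (\<kappa> * M) / (1 - 2 powr (- (e / 2)))"

lemma distortion:
  assumes "bridge n x y" "z \<in> {x..y}" "w \<in> {x..y}"
  shows "D n z \<le> exp T * D n w"
proof -
  define c where "c = (\<lambda>k. sqrt (\<kappa> * M) * (2 powr (- (e / 2))) ^ (n - Suc k))"
  have \<theta>: "0 < (2::real) powr (- (e / 2))" "(2::real) powr (- (e / 2)) < 1"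
    using e powr_less_mono[of "- (e / 2)" 0 "2::real"] by auto
  have osc: "\<bar>\<eta>' ((\<eta> ^^ k) z) - \<eta>' ((\<eta> ^^ k) w)\<bar> \<le> c k" if k: "k < n" for k
  proof -
    let ?d = "\<bar>\<eta>' ((\<eta> ^^ k) z) - \<eta>' ((\<eta> ^^ k) w)\<bar>" and ?t = "\<bar>(\<eta> ^^ k) z - (\<eta> ^^ k) w\<bar>"
    obtain m where n: "n = Suc (k + m)" using less_imp_Suc_add[OF k] by blast
    obtain I where I: "I \<in> {{a\<^sub>0..b\<^sub>0}, {a\<^sub>1..b\<^sub>1}}" "(\<eta> ^^ k) ` {x..y} \<subseteq> I"
      using assms(1) k unfolding bridge_def by blast
    \<comment> \<open>From time k on, m + 1 iterations expand by at least 2 each and end in a hull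
      of length at most 2; one factor 2 cancels.\<close>
    have "2 ^ Suc m * ?t \<le> \<bar>(\<eta> ^^ n) z - (\<eta> ^^ n) w\<bar>"
      using backward_contraction[OF assms, of k "Suc m"] n by simp
    also have "\<dots> \<le> 2"
      using bridge_range[OF assms(1,2)] bridge_range[OF assms(1,3)] order(4) by auto
    finally have "?t \<le> 2 powr (- real m)" by (simp add: powr_minus powr_realpow field_simps)
    then have "?t powr e \<le> (2 powr (- real m)) powr e" using e by (intro powr_mono2) auto
    then have "M * ?t powr e \<le> M * (2 powr (- real m)) powr e" using M by (intro mult_left_mono)
    moreover have "(\<eta> ^^ k) z \<in> I" "(\<eta> ^^ k) w \<in> I" using I(2) assms(2,3) by blast+
    then have "?d \<le> M * ?t powr e" by (rule hoelder[OF I(1)])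
    ultimately have d: "?d \<le> M * (2 powr (- real m)) powr e" by simp
    have "?d \<le> \<kappa>" using oscillation bridge_orbit[OF assms(1)] assms k unfolding S_def by blast
    then have "?d * ?d \<le> \<kappa> * (M * (2 powr (- real m)) powr e)"
      using d kappa_nonneg by (intro mult_mono) auto
    then have "?d \<le> sqrt (\<kappa> * (M * (2 powr (- real m)) powr e))"
      by (intro real_le_rsqrt) (simp add: power2_eq_square)
    also have "\<dots> = sqrt (\<kappa> * M) * sqrt ((2 powr (- real m)) powr e)"
      by (simp add: real_sqrt_mult mult.assoc)
    also have "sqrt ((2 powr (- real m)) powr e) = (2 powr (- (e / 2))) ^ m"
      by (simp add: powr_half_sqrt[symmetric] powr_powr powr_realpow[symmetric] mult_ac)
    finally show ?thesis by (simp add: c_def n)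
  qed
  have c0: "c k \<ge> 0" for k unfolding c_def using kappa_nonneg M by auto
  have "D n z \<le> (\<Prod>k<n. exp (c k) * \<eta>' ((\<eta> ^^ k) w))"
    unfolding D_def
  proof (intro prod_mono conjI)
    fix k assume k: "k \<in> {..<n}"
    have z: "2 \<le> \<eta>' ((\<eta> ^^ k) z)" and w: "2 \<le> \<eta>' ((\<eta> ^^ k) w)"
      using expanding bridge_orbit[OF assms(1)] assms k unfolding S_def by blast+
    show "0 \<le> \<eta>' ((\<eta> ^^ k) z)" using z by simp
    \<comment> \<open>The additive error becomes a factor because the derivative is at least
      1.\<close>
    have "\<eta>' ((\<eta> ^^ k) z) \<le> \<eta>' ((\<eta> ^^ k) w) + c k" using osc[of k] k by auto
    also have "\<dots> \<le> \<eta>' ((\<eta> ^^ k) w) + c k * \<eta>' ((\<eta> ^^ k) w)"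
      using w c0[of k] mult_left_mono[of 1 "\<eta>' ((\<eta> ^^ k) w)" "c k"] by simp
    also have "\<dots> = (1 + c k) * \<eta>' ((\<eta> ^^ k) w)" by (simp add: algebra_simps)
    also have "\<dots> \<le> exp (c k) * \<eta>' ((\<eta> ^^ k) w)" using w by (intro mult_right_mono) auto
    finally show "\<eta>' ((\<eta> ^^ k) z) \<le> exp (c k) * \<eta>' ((\<eta> ^^ k) w)" .
  qed
  also have "\<dots> = exp (\<Sum>k<n. c k) * D n w" by (simp add: prod.distrib exp_sum D_def)
  also have "\<dots> \<le> exp T * D n w"
  proof -
    have "(\<Sum>k<n. (2 powr (- (e / 2))) ^ (n - Suc k)) = (\<Sum>k<n. (2 powr (- (e / 2)) :: real) ^ k)"
      by (rule sum.nat_diff_reindex)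
    also have "\<dots> \<le> (\<Sum>k. (2 powr (- (e / 2))) ^ k)"
      using \<theta> by (intro sum_le_suminf summable_geometric) auto
    also have "\<dots> = 1 / (1 - 2 powr (- (e / 2)))" using \<theta> by (intro suminf_geometric) auto
    finally have "sqrt (\<kappa> * M) * (\<Sum>k<n. (2 powr (- (e / 2))) ^ (n - Suc k))
        \<le> sqrt (\<kappa> * M) * (1 / (1 - 2 powr (- (e / 2))))"
      using kappa_nonneg M by (intro mult_left_mono) auto
    then have "(\<Sum>k<n. c k) \<le> T" by (simp add: c_def T_def sum_distrib_left)
    then show ?thesis using bridge_derivative(2)[OF assms(1,3)] by simp
  qed
  finally show ?thesis .
qed

text \<open>A subinterval of a bridge is the preimage of a subinterval of the hull; by the mean value
  theorem the two proportions differ by a quotient of values of \<open>D\<close> only.\<close>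

lemma proportion:
  assumes b: "bridge n x y" and uv: "x \<le> u" "u < v" "v \<le> y"
  shows "(v - u) * (b\<^sub>1 - a\<^sub>0) \<le> exp T * ((\<eta> ^^ n) v - (\<eta> ^^ n) u) * (y - x)"
    "((\<eta> ^^ n) v - (\<eta> ^^ n) u) * (y - x) \<le> exp T * (v - u) * (b\<^sub>1 - a\<^sub>0)"
proof -
  have xy: "x < y" "(\<eta> ^^ n) x = a\<^sub>0" "(\<eta> ^^ n) y = b\<^sub>1" using b by (auto simp: bridge_def)
  obtain z where z: "u < z" "z < v" "(\<eta> ^^ n) v - (\<eta> ^^ n) u = (v - u) * D n z"
    using MVT2[OF uv(2), of "\<eta> ^^ n" "D n"] bridge_derivative(1)[OF b] uv by auto
  obtain w where w: "x < w" "w < y" "b\<^sub>1 - a\<^sub>0 = (y - x) * D n w"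
    using MVT2[OF xy(1), of "\<eta> ^^ n" "D n"] bridge_derivative(1)[OF b] xy by auto
  have dist: "D n z \<le> exp T * D n w" "D n w \<le> exp T * D n z"
    using distortion[OF b, of z w] distortion[OF b, of w z] z w uv by auto
  have pos: "(v - u) * (y - x) \<ge> 0" using uv xy by simp
  show "(v - u) * (b\<^sub>1 - a\<^sub>0) \<le> exp T * ((\<eta> ^^ n) v - (\<eta> ^^ n) u) * (y - x)"
    unfolding z(3) w(3) using mult_left_mono[OF dist(2) pos] by (simp add: mult_ac)
  show "((\<eta> ^^ n) v - (\<eta> ^^ n) u) * (y - x) \<le> exp T * (v - u) * (b\<^sub>1 - a\<^sub>0)"
    unfolding z(3) w(3) using mult_left_mono[OF dist(1) pos] by (simp add: mult_ac)
qed

lemma bridge_child: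
  assumes b: "bridge n x y" and xuvy: "x \<le> u" "u < v" "v \<le> y"
    and I: "{(\<eta> ^^ n) u..(\<eta> ^^ n) v} \<in> {{a\<^sub>0..b\<^sub>0}, {a\<^sub>1..b\<^sub>1}}"
    and ends: "\<eta> ((\<eta> ^^ n) u) = a\<^sub>0" "\<eta> ((\<eta> ^^ n) v) = b\<^sub>1"
  shows "bridge (Suc n) u v"
  unfolding bridge_def
proof (intro conjI allI impI)
  fix k assume "k < Suc n"
  show "\<exists>I\<in>{{a\<^sub>0..b\<^sub>0}, {a\<^sub>1..b\<^sub>1}}. (\<eta> ^^ k) ` {u..v} \<subseteq> I"
  proof (cases "k = n")
    case True
    have "(\<eta> ^^ n) z \<in> {(\<eta> ^^ n) u..(\<eta> ^^ n) v}" if "z \<in> {u..v}" for z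
      using bridge_strict_mono[OF b, of u z] bridge_strict_mono[OF b, of z v] that xuvy
      by (cases "z = u"; cases "z = v") auto
    then show ?thesis using I True by blast
  next
    case False
    then have "k < n" using \<open>k < Suc n\<close> by simp
    then obtain J where J: "J \<in> {{a\<^sub>0..b\<^sub>0}, {a\<^sub>1..b\<^sub>1}}" "(\<eta> ^^ k) ` {x..y} \<subseteq> J"
      using b unfolding bridge_def by blast
    have "{u..v} \<subseteq> {x..y}" using xuvy by auto
    then have "(\<eta> ^^ k) ` {u..v} \<subseteq> J" using J(2) by blast
    then show ?thesis using J(1) by blast
  qed
qed (use xuvy ends in auto)

lemma bridge_point:
  assumes b: "bridge n x y" and c: "a\<^sub>0 \<le> c" "c \<le> b\<^sub>1"
  obtains u where "x \<le> u" "u \<le> y" "(\<eta> ^^ n) u = c"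
proof -
  have "continuous_on {x..y} (\<eta> ^^ n)"
    using DERIV_isCont[OF bridge_derivative(1)[OF b]] by (intro continuous_at_imp_continuous_on
        ballI)
  moreover have "(\<eta> ^^ n) x \<le> c" "c \<le> (\<eta> ^^ n) y" "x \<le> y"
    using b c by (simp_all add: bridge_def)
  ultimately show ?thesis using IVT'[of "\<eta> ^^ n" x c y] that by blast
qed

text \<open>The halves of a bridge are its preimages of the two Markov intervals. By
  \<open>proportion\<close>, their relative lengths are those of the Markov intervals in the hull up
  to a factor exp \<open>T\<close>, for which r and s leave room.\<close>

lemma bridges:
  assumes L: "L = (\<Inter>n. (\<eta> ^^ n) -` S)"
    and r: "r * exp T * (b\<^sub>1 - a\<^sub>0) \<le> b\<^sub>0 - a\<^sub>0" "r * exp T * (b\<^sub>1 - a\<^sub>0) \<le> b\<^sub>1 - a\<^sub>1"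
    and s: "exp T * (b\<^sub>0 - a\<^sub>0) \<le> s * (b\<^sub>1 - a\<^sub>0)" "exp T * (b\<^sub>1 - a\<^sub>1) \<le> s * (b\<^sub>1 - a\<^sub>0)"
  shows "bridge_family r s L {(x, y). \<exists>n. bridge n x y}"
proof -
  have hull: "b\<^sub>1 - a\<^sub>0 > 0" using order by simp
  have ratio: "v - u \<in> {r * (y - x)..s * (y - x)}"
    if b: "bridge n x y" and uv: "x \<le> u" "u < v" "v \<le> y"
      and c: "(\<eta> ^^ n) v - (\<eta> ^^ n) u = c"
      and rc: "r * exp T * (b\<^sub>1 - a\<^sub>0) \<le> c" and sc: "exp T * c \<le> s * (b\<^sub>1 - a\<^sub>0)" for n x y u v c
  proof -
    have xy: "y - x > 0" using b by (simp add: bridge_def)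
    have "exp T * (r * (y - x)) * (b\<^sub>1 - a\<^sub>0) \<le> c * (y - x)"
      using mult_right_mono[OF rc, of "y - x"] xy by (simp add: mult_ac)
    also have "\<dots> \<le> exp T * (v - u) * (b\<^sub>1 - a\<^sub>0)" using proportion(2)[OF b uv] c by simp
    finally have 1: "r * (y - x) \<le> v - u" using hull by simp
    have "(v - u) * (b\<^sub>1 - a\<^sub>0) \<le> exp T * c * (y - x)" using proportion(1)[OF b uv] c by simp
    also have "\<dots> \<le> s * (y - x) * (b\<^sub>1 - a\<^sub>0)"
      using mult_right_mono[OF sc, of "y - x"] xy by (simp add: mult_ac)
    finally show ?thesis using 1 hull by simp
  qed
  show ?thesis
    unfolding bridge_family_def
  proof (clarify, intro conjI)
    fix n x y assume b: "bridge n x y"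
    then show xy: "x < y" by (simp add: bridge_def)
    have ends: "(\<eta> ^^ n) x = a\<^sub>0" "(\<eta> ^^ n) y = b\<^sub>1" using b by (auto simp: bridge_def)
    have fix0: "(\<eta> ^^ k) a\<^sub>0 = a\<^sub>0" for k by (induction k) (auto simp: endpoints)
    \<comment> \<open>The left end of a bridge reaches the fixed point \<open>a\<^sub>0\<close>, so
      it belongs to L.\<close>
    have "(\<eta> ^^ m) x \<in> S" for m
    proof (cases "m < n")
      case True
      then show ?thesis using bridge_orbit[OF b, of x] xy by simp
    next
      case False
      then have "(\<eta> ^^ m) x = (\<eta> ^^ (m - n)) ((\<eta> ^^ n) x)"
        by (metis funpow_add comp_apply le_add_diff_inverse2 not_less)
      then show ?thesis using ends fix0 order by (simp add: S_def)
    qed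
    then show "L \<inter> {x..y} \<noteq> {}" unfolding L using xy by force
    obtain u where u: "x \<le> u" "u \<le> y" "(\<eta> ^^ n) u = b\<^sub>0"
      using bridge_point[OF b, of b\<^sub>0] order by auto
    obtain v where v: "x \<le> v" "v \<le> y" "(\<eta> ^^ n) v = a\<^sub>1"
      using bridge_point[OF b, of a\<^sub>1] order by auto
    have xu: "x < u" using u ends order by (cases "x = u") auto
    have vy: "v < y" using v ends order by (cases "v = y") auto
    have "bridge (Suc n) x u" using bridge_child[OF b order_refl xu u(2)] u(3) ends endpoints by
        simp
    moreover have "bridge (Suc n) v y" using bridge_child[OF b v(1) vy order_refl] v(3) ends
        endpoints by simp
    moreover have "u - x \<in> {r * (y - x)..s * (y - x)}"
      using ratio[OF b order_refl xu u(2) _ r(1) s(1)] u(3) ends by simp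
    moreover have "y - v \<in> {r * (y - x)..s * (y - x)}"
      using ratio[OF b v(1) vy order_refl _ r(2) s(2)] v(3) ends by simp
    ultimately show "\<exists>u v. (x, u) \<in> {(x, y). \<exists>n. bridge n x y} \<and> (v, y) \<in> {(x, y). \<exists>n. bridge n x
        y} \<and>
        u - x \<in> {r * (y - x)..s * (y - x)} \<and> y - v \<in> {r * (y - x)..s * (y - x)}" by blast
  qed
qed

lemma bridge_0: "bridge 0 a\<^sub>0 b\<^sub>1"
  using order by (simp add: bridge_def)

end

section \<open>Perturbed affine Cantor sets\<close>

text \<open>At an end point the formula for f is known on one side only; differentiability makes the
  one-sided derivative the value of \<open>deriv\<close>.\<close>

lemma deriv_affine_on_interval:
  fixes f :: "real \<Rightarrow> real"
  assumes "u < v" "x \<in> {u..v}" "f differentiable (at x)" "\<forall>y\<in>{u..v}. f y = m * y + c"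
  shows "deriv f x = m"
proof -
  have "((\<lambda>y. m * y + c) has_real_derivative m) (at x within {u..v})"
    by (auto intro!: derivative_eq_intros)
  then have "(f has_real_derivative m) (at x within {u..v})"
    by (rule has_field_derivative_transform_within[of _ _ _ _ 1]) (use assms in auto)
  moreover have "(f has_real_derivative deriv f x) (at x within {u..v})"
    using assms(3) by (metis DERIV_deriv_iff_real_differentiable has_field_derivative_at_within)
  moreover have "at x within {u..v} \<noteq> bot"
    using assms(1,2) by (simp add: trivial_limit_within islimpt_Icc)
  ultimately show ?thesis using has_field_derivative_unique by blast
qed

lemma regular_cantor_set_differentiable:
  assumes "regular_cantor_set K P \<psi>" "x \<in> pieces P"
  shows "\<psi> differentiable (at x)"
proof -
  have "\<exists>\<epsilon>>0. \<exists>U C. open U \<and> pieces P \<subseteq> U \<and>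
      (\<forall>x\<in>U. \<psi> differentiable (at x) \<and> \<bar>deriv \<psi> x\<bar> > 1) \<and>
      (\<forall>x\<in>U. \<forall>y\<in>U. \<bar>deriv \<psi> x - deriv \<psi> y\<bar> \<le> C * \<bar>x - y\<bar> powr \<epsilon>)"
    using assms(1) unfolding regular_cantor_set_def by (elim conjE)
  then show ?thesis using assms(2) by (elim exE conjE) (simp add: subset_iff)
qed

text \<open>Closeness controls \<eta> composed with an affine map of slope m = p (b - a), where |m -
  1| \<le> 2 \<delta> p. The bound on \<delta> gives m \<ge> 1/2, and dividing by m yields the
  factor 2 in the last estimate.\<close>

lemma close_branch:
  fixes \<eta> \<phi> :: "real \<Rightarrow> real"
  assumes p: "p > 2.5" and \<delta>: "0 < \<delta>" "\<delta> \<le> 1 / (16 * (1 + 2 * p\<^sup>2))"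
    and uv: "v - u = 1 / p" and ab: "a < b" "\<bar>a - u\<bar> < \<delta>" "\<bar>b - v\<bar> < \<delta>"
    and diff: "\<And>z. z \<in> {a..b} \<Longrightarrow> \<eta> differentiable (at z)"
    and close: "\<And>x. x \<in> {u..v} \<Longrightarrow> \<bar>(\<eta> \<circ> affine_onto (u, v) (a, b)) x - \<phi> x\<bar> < \<delta> \<and>
        \<bar>deriv (\<eta> \<circ> affine_onto (u, v) (a, b)) x - p\<bar> < \<delta>"
  shows "\<bar>\<eta> a - \<phi> u\<bar> < \<delta>" "\<bar>\<eta> b - \<phi> v\<bar> < \<delta>"
    "\<And>z. z \<in> {a..b} \<Longrightarrow> \<bar>deriv \<eta> z - p\<bar> \<le> 2 * \<delta> * (1 + 2 * p\<^sup>2)"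
proof -
  have "u < v" using uv p by (smt (verit) divide_pos_pos)
  have "affine_onto (u, v) (a, b) u = a" "affine_onto (u, v) (a, b) v = b"
    using \<open>u < v\<close> by (auto simp: affine_onto_def)
  then show "\<bar>\<eta> a - \<phi> u\<bar> < \<delta>" "\<bar>\<eta> b - \<phi> v\<bar> < \<delta>"
    using close[of u] close[of v] \<open>u < v\<close> by auto
  fix z assume z: "z \<in> {a..b}"
  define m where "m = (b - a) / (v - u)"
  define x where "x = u + (z - a) / m"
  have m0: "m > 0" using ab \<open>u < v\<close> by (simp add: m_def)
  have Ax: "affine_onto (u, v) (a, b) y = a + (y - u) * m" for y by (simp add: affine_onto_def
      m_def)
  have "(z - a) / m \<le> (b - a) / m" using z m0 by (intro divide_right_mono) auto
  also have "(b - a) / m = v - u" using ab \<open>u < v\<close> by (simp add: m_def)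
  finally have x: "x \<in> {u..v}" using z m0 by (simp add: x_def)
  have "affine_onto (u, v) (a, b) x = z" using m0 by (simp add: Ax x_def)
  moreover have "(affine_onto (u, v) (a, b) has_real_derivative m) (at x)"
    unfolding Ax[abs_def] by (auto intro!: derivative_eq_intros)
  moreover have "(\<eta> has_real_derivative deriv \<eta> z) (at z)"
    using diff[OF z] DERIV_deriv_iff_real_differentiable by blast
  ultimately have "((\<eta> \<circ> affine_onto (u, v) (a, b)) has_real_derivative deriv \<eta> z * m) (at x)"
    using DERIV_chain by blast
  then have d: "\<bar>deriv \<eta> z * m - p\<bar> < \<delta>" using close[OF x] DERIV_imp_deriv by fastforce
  have "m = (b - a) * p" by (simp add: m_def uv)
  moreover have "(v - u) * p = 1" using p by (simp add: uv)
  ultimately have "m - 1 = (b - v - (a - u)) * p" by (simp add: algebra_simps)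
  then have "\<bar>m - 1\<bar> = \<bar>b - v - (a - u)\<bar> * p" using p by (simp add: abs_mult)
  also have "\<dots> \<le> (2 * \<delta>) * p" using ab p by (intro mult_right_mono) auto
  finally have m1: "\<bar>m - 1\<bar> \<le> 2 * \<delta> * p" .
  have q: "\<delta> * (1 + 2 * p\<^sup>2) \<le> 1 / 16"
    using \<delta> by (simp add: field_simps add_pos_nonneg)
  have "p \<le> 2 * p\<^sup>2" using p mult_right_mono[of 1 "2 * p" p] by (simp add: power2_eq_square mult_ac)
  then have "\<delta> * p \<le> \<delta> * (1 + 2 * p\<^sup>2)" using \<delta> by (intro mult_left_mono) auto
  then have half: "m \<ge> 1 / 2" using m1 q by linarith
  have "\<bar>(deriv \<eta> z - p) * m\<bar> = \<bar>(deriv \<eta> z * m - p) - p * (m - 1)\<bar>" by (simp add: algebra_simps)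
  also have "\<dots> \<le> \<bar>deriv \<eta> z * m - p\<bar> + \<bar>p * (m - 1)\<bar>" by (rule abs_triangle_ineq4)
  also have "\<bar>p * (m - 1)\<bar> \<le> p * (2 * \<delta> * p)" using m1 p by (simp add: abs_mult)
  also have "p * (2 * \<delta> * p) = \<delta> * (2 * p\<^sup>2)" by (simp add: power2_eq_square)
  also have "\<bar>(deriv \<eta> z - p) * m\<bar> = \<bar>deriv \<eta> z - p\<bar> * m" using m0 by (simp add: abs_mult)
  finally have "\<bar>deriv \<eta> z - p\<bar> * m \<le> \<delta> * (1 + 2 * p\<^sup>2)"
    using d unfolding distrib_left by linarith
  moreover have "\<bar>deriv \<eta> z - p\<bar> * (1 / 2) \<le> \<bar>deriv \<eta> z - p\<bar> * m"
    using half by (intro mult_left_mono) auto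
  ultimately have "\<bar>deriv \<eta> z - p\<bar> * (1 / 2) \<le> \<delta> * (1 + 2 * p\<^sup>2)" by (rule order_trans[rotated])
  from mult_left_mono[OF this, of 2] show "\<bar>deriv \<eta> z - p\<bar> \<le> 2 * \<delta> * (1 + 2 * p\<^sup>2)"
    by (simp add: mult.assoc)
qed

text \<open>Closeness fixes the values of \<eta> at the end points only up to \<delta>, but the
  Markov condition makes them exact: the image of a piece is the hull of some pieces and comes near
  0 and 1, so it involves both pieces and is the whole hull. The Hoelder data are relaxed to C + 1
  and \<epsilon> / 2, so only the oscillation bound depends on \<delta>.\<close>

lemma close_two_branch_map:
  fixes p :: real
  defines "P \<equiv> [(0, 1 / p), (1 - 1 / p, 1)]"
  assumes p: "p > 2.5" and K: "regular_cantor_set K P \<phi>"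
    and \<phi>: "\<forall>x\<in>{0..1 / p}. \<phi> x = p * x" "\<forall>x\<in>{1 - 1 / p..1}. \<phi> x = p * x - p + 1"
    and C: "C > 0" "\<epsilon> > 0" and \<delta>: "0 < \<delta>" "\<delta> \<le> 1 / (16 * (1 + 2 * p\<^sup>2))" "\<delta> \<le> \<epsilon> / 2"
    and L: "regular_cantor_set L Q \<eta>" and close: "delta_close \<delta> C \<epsilon> P \<phi> Q \<eta>"
  shows "two_branch_map \<eta> (deriv \<eta>) (fst (Q ! 0)) (snd (Q ! 0)) (fst (Q ! 1)) (snd (Q ! 1))
      (4 * \<delta> * (1 + 2 * p\<^sup>2)) (C + 1) (\<epsilon> / 2)"
    "L = (\<Inter>n. (\<eta> ^^ n) -` ({fst (Q ! 0)..snd (Q ! 0)} \<union> {fst (Q ! 1)..snd (Q ! 1)}))"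
proof -
  define a\<^sub>0 b\<^sub>0 a\<^sub>1 b\<^sub>1 where ends: "a\<^sub>0 = fst (Q ! 0)" "b\<^sub>0 = snd (Q ! 0)" "a\<^sub>1 = fst (Q ! 1)"
      "b\<^sub>1 = snd (Q ! 1)"
  have ip: "0 < 1 / p" "1 / p < 0.4" using p by (auto simp: field_simps)
  have "p\<^sup>2 > 2.5\<^sup>2" using p by (intro power_strict_mono) auto
  then have "16 * (1 + 2 * p\<^sup>2) > 100" by (simp add: power2_eq_square)
  then have "1 / (16 * (1 + 2 * p\<^sup>2)) < 1 / 100" by (intro divide_strict_left_mono) auto
  then have small: "\<delta> < 0.01" using \<delta>(2) by simp
  \<comment> \<open>This keeps the derivative within 1/8 of p > 2.5, hence above 2.\<close>
  have osc: "2 * \<delta> * (1 + 2 * p\<^sup>2) \<le> 1 / 8"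
    using \<delta> by (simp add: field_simps add_pos_nonneg)
  have lenQ: "length Q = 2" using close by (simp add: delta_close_def P_def)
  have "{..<2::nat} = {0, 1}" by auto
  then have pieces: "piece Q 0 = {a\<^sub>0..b\<^sub>0}" "piece Q 1 = {a\<^sub>1..b\<^sub>1}"
      "pieces Q = {a\<^sub>0..b\<^sub>0} \<union> {a\<^sub>1..b\<^sub>1}"
    by (auto simp: piece_def pieces_def ends lenQ)
  have pieceP: "piece P 0 = {0..1 / p}" "piece P 1 = {1 - 1 / p..1}" by (auto simp: piece_def P_def)
  have near: "\<bar>a\<^sub>0 - 0\<bar> < \<delta>" "\<bar>b\<^sub>0 - 1 / p\<bar> < \<delta>" "\<bar>a\<^sub>1 - (1 - 1 / p)\<bar> < \<delta>" "\<bar>b\<^sub>1 - 1\<bar> < \<delta>"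
  proof -
    have *: "\<bar>fst (Q ! i) - fst (P ! i)\<bar> < \<delta> \<and> \<bar>snd (Q ! i) - snd (P ! i)\<bar> < \<delta>" if "i < 2" for i
      using close that by (simp add: delta_close_def P_def)
    show "\<bar>a\<^sub>0 - 0\<bar> < \<delta>" "\<bar>b\<^sub>0 - 1 / p\<bar> < \<delta>" "\<bar>a\<^sub>1 - (1 - 1 / p)\<bar> < \<delta>" "\<bar>b\<^sub>1 - 1\<bar> < \<delta>"
      using *[of 0] *[of 1] by (simp_all add: ends P_def)
  qed
  have "fst (Q ! i) < snd (Q ! i)" if "i < 2" for i
    using L that lenQ by (auto simp: regular_cantor_set_def)
  from this[of 0] this[of 1] have order: "a\<^sub>0 < b\<^sub>0" "a\<^sub>1 < b\<^sub>1" by (auto simp: ends)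
  have order': "b\<^sub>0 < a\<^sub>1" "b\<^sub>1 - a\<^sub>0 \<le> 2" using near ip small by auto
  have diff: "\<eta> differentiable (at z)" if "z \<in> {a\<^sub>0..b\<^sub>0} \<union> {a\<^sub>1..b\<^sub>1}" for z
    using regular_cantor_set_differentiable[OF L, of z] that unfolding pieces(3) by blast
  have der\<phi>: "deriv \<phi> x = p" if "i < 2" "x \<in> piece P i" for i x
  proof -
    have "x \<in> pieces P" using that by (auto simp: pieces_def P_def)
    then have d: "\<phi> differentiable (at x)" by (rule regular_cantor_set_differentiable[OF K])
    consider "i = 0" | "i = 1" using \<open>i < 2\<close> by linarith
    then show ?thesis
    proof cases
      case 1
      then show ?thesis
        using deriv_affine_on_interval[OF ip(1) _ d, of p 0] that(2) \<phi>(1) pieceP(1) by simp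
    next
      case 2
      then have x: "x \<in> {1 - 1 / p..1}" using that(2) pieceP(2) by simp
      have "1 - 1 / p < 1" "\<forall>y\<in>{1 - 1 / p..1}. \<phi> y = p * y + (1 - p)" using \<phi>(2) ip by simp_all
      then show ?thesis by (rule deriv_affine_on_interval[OF _ x d])
    qed
  qed
  have cl: "\<bar>(\<eta> \<circ> affine_onto (P ! i) (Q ! i)) x - \<phi> x\<bar> < \<delta> \<and>
      \<bar>deriv (\<eta> \<circ> affine_onto (P ! i) (Q ! i)) x - deriv \<phi> x\<bar> < \<delta>" if "i < 2" "x \<in> piece P i" for i
          x
    using close that by (simp add: delta_close_def P_def)
  have Q: "Q ! 0 = (a\<^sub>0, b\<^sub>0)" "Q ! 1 = (a\<^sub>1, b\<^sub>1)" by (simp_all add: ends)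
  have PP: "P ! 0 = (0, 1 / p)" "P ! 1 = (1 - 1 / p, 1)" by (simp_all add: P_def)
  have cl0: "\<bar>(\<eta> \<circ> affine_onto (0, 1 / p) (a\<^sub>0, b\<^sub>0)) x - \<phi> x\<bar> < \<delta> \<and>
      \<bar>deriv (\<eta> \<circ> affine_onto (0, 1 / p) (a\<^sub>0, b\<^sub>0)) x - p\<bar> < \<delta>" if "x \<in> {0..1 / p}" for x
    using cl[of 0 x] der\<phi>[of 0 x] that unfolding Q PP pieceP by simp
  have cl1: "\<bar>(\<eta> \<circ> affine_onto (1 - 1 / p, 1) (a\<^sub>1, b\<^sub>1)) x - \<phi> x\<bar> < \<delta> \<and>
      \<bar>deriv (\<eta> \<circ> affine_onto (1 - 1 / p, 1) (a\<^sub>1, b\<^sub>1)) x - p\<bar> < \<delta>" if "x \<in> {1 - 1 / p..1}" for x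
    using cl[of 1 x] der\<phi>[of 1 x] that unfolding Q PP pieceP by simp
  have b0: "\<bar>\<eta> a\<^sub>0 - \<phi> 0\<bar> < \<delta>" "\<bar>\<eta> b\<^sub>0 - \<phi> (1 / p)\<bar> < \<delta>"
      "\<And>z. z \<in> {a\<^sub>0..b\<^sub>0} \<Longrightarrow> \<bar>deriv \<eta> z - p\<bar> \<le> 2 * \<delta> * (1 + 2 * p\<^sup>2)"
    by (rule close_branch[OF p \<delta>(1,2) _ order(1) near(1,2) _ cl0]; use diff in simp)+
  have b1: "\<bar>\<eta> a\<^sub>1 - \<phi> (1 - 1 / p)\<bar> < \<delta>" "\<bar>\<eta> b\<^sub>1 - \<phi> 1\<bar> < \<delta>"
      "\<And>z. z \<in> {a\<^sub>1..b\<^sub>1} \<Longrightarrow> \<bar>deriv \<eta> z - p\<bar> \<le> 2 * \<delta> * (1 + 2 * p\<^sup>2)"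
    by (rule close_branch[OF p \<delta>(1,2) _ order(2) near(3,4) _ cl1]; use diff in simp)+
  have "\<phi> 0 = 0" "\<phi> (1 / p) = 1" "\<phi> (1 - 1 / p) = 0" "\<phi> 1 = 1" 
    using \<phi>(1)[rule_format, of 0] \<phi>(1)[rule_format, of "1 / p"] \<phi>(2)[rule_format, of "1 - 1 / p"]
      \<phi>(2)[rule_format, of 1] ip p by (simp_all add: right_diff_distrib)
  note vals = b0(1,2)[unfolded this] b1(1,2)[unfolded this]
  have osc': "\<bar>deriv \<eta> z - p\<bar> \<le> 2 * \<delta> * (1 + 2 * p\<^sup>2)" if "z \<in> {a\<^sub>0..b\<^sub>0} \<union> {a\<^sub>1..b\<^sub>1}" for z
    using that b0(3) b1(3) by blast
  then have exp2: "2 \<le> deriv \<eta> z" if "z \<in> {a\<^sub>0..b\<^sub>0} \<union> {a\<^sub>1..b\<^sub>1}" for z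
    using osc'[OF that] osc p by (simp add: abs_le_iff)
  have der: "(\<eta> has_real_derivative deriv \<eta> z) (at z)" if "z \<in> {a\<^sub>0..b\<^sub>0} \<union> {a\<^sub>1..b\<^sub>1}" for z
    using diff[OF that] DERIV_deriv_iff_real_differentiable by blast
  have onto: "\<eta> a = a\<^sub>0 \<and> \<eta> b = b\<^sub>1"
    if "i < 2" "piece Q i = {a..b}" "a < b" "\<bar>\<eta> a\<bar> < \<delta>" "\<bar>\<eta> b - 1\<bar> < \<delta>" for i a b
  proof -
    have "\<exists>J. J \<subseteq> {..<2} \<and> \<eta> ` {a..b} = convex hull (\<Union>j\<in>J. piece Q j)"
    proof -
      have "\<forall>i<length Q. \<exists>J\<subseteq>{..<length Q}. \<eta> ` piece Q i = convex hull (\<Union>j\<in>J. piece Q j)"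
        using L unfolding regular_cantor_set_def by (elim conjE)
      then show ?thesis using that(1,2) lenQ by metis
    qed
    then obtain J where J: "J \<subseteq> {..<2}" "\<eta> ` {a..b} = convex hull (\<Union>j\<in>J. piece Q j)"
      by blast
    have mem: "\<eta> a \<in> convex hull (\<Union>j\<in>J. piece Q j)" "\<eta> b \<in> convex hull (\<Union>j\<in>J. piece Q j)"
      using J(2) that(3) by (metis atLeastAtMost_iff image_eqI less_imp_le order_refl)+
    have 0: "0 \<in> J"
    proof (rule ccontr)
      assume "0 \<notin> J"
      have "j = 1" if "j \<in> J" for j
        using J(1) that \<open>0 \<notin> J\<close> less_2_cases[of j] by (metis lessThan_iff subsetD One_nat_def)
      then have "(\<Union>j\<in>J. piece Q j) \<subseteq> {a\<^sub>1..b\<^sub>1}" using pieces(2) by (intro UN_least) (metis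
          order_refl)
      then have "convex hull (\<Union>j\<in>J. piece Q j) \<subseteq> {a\<^sub>1..b\<^sub>1}" by (intro hull_minimal) auto
      then have "\<eta> a \<in> {a\<^sub>1..b\<^sub>1}" using mem by blast
      then show False using that(4) near small ip by auto
    qed
    have 1: "1 \<in> J"
    proof (rule ccontr)
      assume "1 \<notin> J"
      have "j = 0" if "j \<in> J" for j
        using J(1) that \<open>1 \<notin> J\<close> less_2_cases[of j] by (metis lessThan_iff subsetD One_nat_def)
      then have "(\<Union>j\<in>J. piece Q j) \<subseteq> {a\<^sub>0..b\<^sub>0}" using pieces(1) by (intro UN_least) (metis
          order_refl)
      then have "convex hull (\<Union>j\<in>J. piece Q j) \<subseteq> {a\<^sub>0..b\<^sub>0}" by (intro hull_minimal) auto
      then have "\<eta> b \<in> {a\<^sub>0..b\<^sub>0}" using mem by blast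
      then show False using that(5) near small ip by auto
    qed
    have "(\<Union>j\<in>J. piece Q j) \<subseteq> {a\<^sub>0..b\<^sub>1}"
    proof -
      have "(\<Union>j\<in>J. piece Q j) \<subseteq> {a\<^sub>0..b\<^sub>0} \<union> {a\<^sub>1..b\<^sub>1}"
        using J(1) lenQ by (fold pieces(3)) (auto simp: pieces_def)
      also have "\<dots> \<subseteq> {a\<^sub>0..b\<^sub>1}" using order order' by auto
      finally show ?thesis .
    qed
    then have hull: "convex hull (\<Union>j\<in>J. piece Q j) \<subseteq> {a\<^sub>0..b\<^sub>1}" by (intro hull_minimal) auto
    have "a\<^sub>0 \<in> (\<Union>j\<in>J. piece Q j)" "b\<^sub>1 \<in> (\<Union>j\<in>J. piece Q j)" using 0 1 pieces order by force+
    then have mem': "a\<^sub>0 \<in> \<eta> ` {a..b}" "b\<^sub>1 \<in> \<eta> ` {a..b}"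
      unfolding J(2) using hull_subset[of "\<Union>j\<in>J. piece Q j" convex] by blast+
    have sub: "{a..b} \<subseteq> {a\<^sub>0..b\<^sub>0} \<union> {a\<^sub>1..b\<^sub>1}"
      using pieces(1,2) that(1,2) less_2_cases[of i] by auto
    have mono: "\<eta> z \<le> \<eta> w" if "z \<in> {a..b}" "w \<in> {a..b}" "z \<le> w" for z w
    proof (rule DERIV_nonneg_imp_nondecreasing[OF \<open>z \<le> w\<close>])
      fix t assume "z \<le> t" "t \<le> w"
      then have "t \<in> {a..b}" using that by auto
      then have "t \<in> {a\<^sub>0..b\<^sub>0} \<union> {a\<^sub>1..b\<^sub>1}" using sub by blast
      then show "\<exists>d. (\<eta> has_real_derivative d) (at t) \<and> 0 \<le> d"
        using der exp2 by (metis order_trans zero_le_numeral)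
    qed
    have "\<eta> a \<le> a\<^sub>0" "b\<^sub>1 \<le> \<eta> b" using mem' mono that(3) by auto
    then show ?thesis using mem hull by (meson antisym atLeastAtMost_iff subsetD)
  qed
  have ep: "\<eta> a\<^sub>0 = a\<^sub>0 \<and> \<eta> b\<^sub>0 = b\<^sub>1" "\<eta> a\<^sub>1 = a\<^sub>0 \<and> \<eta> b\<^sub>1 = b\<^sub>1"
    using onto[of 0, OF _ pieces(1) order(1)] onto[of 1, OF _ pieces(2) order(2)] vals by auto
  obtain C' \<epsilon>' where C': "\<bar>C' - C\<bar> < \<delta>" "\<bar>\<epsilon>' - \<epsilon>\<bar> < \<delta>" "holder_deriv Q \<eta> C' \<epsilon>'"
    using close unfolding delta_close_def by blast
  have hoelder: "\<bar>deriv \<eta> z - deriv \<eta> w\<bar> \<le> (C + 1) * \<bar>z - w\<bar> powr (\<epsilon> / 2)"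
    if I: "I \<in> {{a\<^sub>0..b\<^sub>0}, {a\<^sub>1..b\<^sub>1}}" "z \<in> I" "w \<in> I" for I z w
  proof -
    obtain i where i: "i < 2" "I = piece Q i" using I(1) pieces by (metis insertE singletonD
        one_less_numeral_iff semiring_norm(76) zero_less_numeral)
    have "\<bar>deriv \<eta> z - deriv \<eta> w\<bar> \<le> C' * \<bar>z - w\<bar> powr \<epsilon>'"
      using C'(3) I(2,3) i lenQ unfolding holder_deriv_def by auto
    also have "\<dots> \<le> (C + 1) * \<bar>z - w\<bar> powr \<epsilon>'" using C' small by (intro mult_right_mono) auto
    \<comment> \<open>The exponent may be lowered because the points are at distance at most
      1.\<close>
    also have "\<dots> \<le> (C + 1) * \<bar>z - w\<bar> powr (\<epsilon> / 2)"
    proof (intro mult_left_mono powr_mono')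
      show "\<bar>z - w\<bar> \<le> 1" using I near small ip by auto
    qed (use C C'(2) \<delta> in auto)
    finally show ?thesis .
  qed
  show "two_branch_map \<eta> (deriv \<eta>) (fst (Q ! 0)) (snd (Q ! 0)) (fst (Q ! 1)) (snd (Q ! 1))
      (4 * \<delta> * (1 + 2 * p\<^sup>2)) (C + 1) (\<epsilon> / 2)"
    unfolding ends[symmetric]
  proof unfold_locales
    fix z w assume "z \<in> {a\<^sub>0..b\<^sub>0} \<union> {a\<^sub>1..b\<^sub>1}" "w \<in> {a\<^sub>0..b\<^sub>0} \<union> {a\<^sub>1..b\<^sub>1}"
    then show "\<bar>deriv \<eta> z - deriv \<eta> w\<bar> \<le> 4 * \<delta> * (1 + 2 * p\<^sup>2)"
      using osc'[of z] osc'[of w] by linarith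
  qed (use order order' der exp2 hoelder ep C in auto)
  show "L = (\<Inter>n. (\<eta> ^^ n) -` ({fst (Q ! 0)..snd (Q ! 0)} \<union> {fst (Q ! 1)..snd (Q ! 1)}))"
    using L unfolding regular_cantor_set_def pieces(3) ends by (elim conjE)
qed

text \<open>The distortion exponent, here \<tau> \<delta>, is of order sqrt \<delta>. So exp (\<tau>
  \<delta>) tends to 1, and the strict inequalities r < 1 / p < s survive for small
  \<delta>.\<close>

lemma close_bridge_family:
  fixes p r s :: real
  assumes p: "p > 2.5" and rs: "0 \<le> r" "r < 1 / p" "1 / p < s"
    and K: "regular_cantor_set K [(0, 1 / p), (1 - 1 / p, 1)] \<phi>"
    and \<phi>: "\<forall>x\<in>{0..1 / p}. \<phi> x = p * x" "\<forall>x\<in>{1 - 1 / p..1}. \<phi> x = p * x - p + 1"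
    and C: "C > 0" "\<epsilon> > 0"
  shows "\<forall>\<^sub>F \<delta> in at_right 0. \<forall>L Q \<eta>. regular_cantor_set L Q \<eta> \<longrightarrow>
      delta_close \<delta> C \<epsilon> [(0, 1 / p), (1 - 1 / p, 1)] \<phi> Q \<eta> \<longrightarrow>
      (\<exists>\<B>. bridge_family r s L \<B> \<and> (fst (Q ! 0), snd (Q ! 1)) \<in> \<B>)"
proof -
  define \<theta> where "\<theta> = 2 powr (- (\<epsilon> / 2 / 2))"
  define \<tau> where "\<tau> = (\<lambda>\<delta>. sqrt (4 * \<delta> * (1 + 2 * p\<^sup>2) * (C + 1)) / (1 - \<theta>))"
  have "\<theta> < 1" using C powr_less_mono[of "- (\<epsilon> / 2 / 2)" 0 "2::real"] by (simp add: \<theta>_def)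
  then have "(\<tau> \<longlongrightarrow> sqrt (4 * 0 * (1 + 2 * p\<^sup>2) * (C + 1)) / (1 - \<theta>)) (at_right 0)"
    unfolding \<tau>_def by (intro tendsto_intros) auto
  then have \<tau>: "(\<tau> \<longlongrightarrow> 0) (at_right 0)" by simp
  have "((\<lambda>\<delta>. s * (1 - 2 * \<delta>) - exp (\<tau> \<delta>) * (1 / p + 2 * \<delta>))
      \<longlongrightarrow> s * (1 - 2 * 0) - exp 0 * (1 / p + 2 * 0)) (at_right 0)"
    by (intro tendsto_intros \<tau>)
  then have 1: "\<forall>\<^sub>F \<delta> in at_right 0. s * (1 - 2 * \<delta>) - exp (\<tau> \<delta>) * (1 / p + 2 * \<delta>) > 0"
    by (rule order_tendstoD) (use rs in simp)
  have "((\<lambda>\<delta>. 1 / p - 2 * \<delta> - r * exp (\<tau> \<delta>) * (1 + 2 * \<delta>))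
      \<longlongrightarrow> 1 / p - 2 * 0 - r * exp 0 * (1 + 2 * 0)) (at_right 0)"
    by (intro tendsto_intros \<tau>)
  then have 2: "\<forall>\<^sub>F \<delta> in at_right 0. 1 / p - 2 * \<delta> - r * exp (\<tau> \<delta>) * (1 + 2 * \<delta>) > 0"
    by (rule order_tendstoD) (use rs in simp)
  have small: "\<forall>\<^sub>F \<delta> in at_right 0. \<delta> < c" if "c > 0" for c :: real
    by (rule order_tendstoD(2)[OF tendsto_ident_at that])
  have "1 / (16 * (1 + 2 * p\<^sup>2)) > 0" by (simp add: add_pos_nonneg)
  have "\<epsilon> / 2 > 0" using C by simp
  from eventually_at_right_less[of 0] 1 2 small[OF \<open>1 / (16 * (1 + 2 * p\<^sup>2)) > 0\<close>] small[OF this]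
  show ?thesis
  proof (eventually_elim, intro allI impI)
    fix \<delta> L Q \<eta>
    assume \<delta>: "0 < \<delta>" "s * (1 - 2 * \<delta>) - exp (\<tau> \<delta>) * (1 / p + 2 * \<delta>) > 0"
        "1 / p - 2 * \<delta> - r * exp (\<tau> \<delta>) * (1 + 2 * \<delta>) > 0"
        "\<delta> < 1 / (16 * (1 + 2 * p\<^sup>2))" "\<delta> < \<epsilon> / 2"
      and L: "regular_cantor_set L Q \<eta>"
      and close: "delta_close \<delta> C \<epsilon> [(0, 1 / p), (1 - 1 / p, 1)] \<phi> Q \<eta>"
    define a\<^sub>0 b\<^sub>0 a\<^sub>1 b\<^sub>1 where ends: "a\<^sub>0 = fst (Q ! 0)" "b\<^sub>0 = snd (Q ! 0)" "a\<^sub>1 = fst (Q ! 1)"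
        "b\<^sub>1 = snd (Q ! 1)"
    note tb = close_two_branch_map[OF p K \<phi> C \<delta>(1) less_imp_le[OF \<delta>(4)] less_imp_le[OF \<delta>(5)] L
        close,
        folded ends]
    interpret two_branch_map \<eta> "deriv \<eta>" a\<^sub>0 b\<^sub>0 a\<^sub>1 b\<^sub>1 "4 * \<delta> * (1 + 2 * p\<^sup>2)" "C + 1" "\<epsilon> / 2"
      by (rule tb(1))
    have T: "T = \<tau> \<delta>" by (simp add: T_def \<tau>_def \<theta>_def)
    have *: "\<bar>fst (Q ! i) - fst ([(0, 1 / p), (1 - 1 / p, 1)] ! i)\<bar> < \<delta> \<and>
        \<bar>snd (Q ! i) - snd ([(0, 1 / p), (1 - 1 / p, 1)] ! i)\<bar> < \<delta>" if "i < 2" for i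
      using close that by (simp add: delta_close_def)
    have near: "\<bar>a\<^sub>0\<bar> < \<delta>" "\<bar>b\<^sub>0 - 1 / p\<bar> < \<delta>" "\<bar>a\<^sub>1 - (1 - 1 / p)\<bar> < \<delta>" "\<bar>b\<^sub>1 - 1\<bar> < \<delta>"
      using *[of 0] *[of 1] by (simp_all add: ends)
    have "r * exp (\<tau> \<delta>) * (b\<^sub>1 - a\<^sub>0) \<le> r * exp (\<tau> \<delta>) * (1 + 2 * \<delta>)"
      using near rs by (intro mult_left_mono) auto
    then have r: "r * exp T * (b\<^sub>1 - a\<^sub>0) \<le> b\<^sub>0 - a\<^sub>0" "r * exp T * (b\<^sub>1 - a\<^sub>0) \<le> b\<^sub>1 - a\<^sub>1"
      unfolding T using near \<delta>(3) by linarith+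
    have "0 < 1 / p" using p by simp
    then have "s * (1 - 2 * \<delta>) \<le> s * (b\<^sub>1 - a\<^sub>0)" using near rs by (intro mult_left_mono) linarith+
    moreover have "exp (\<tau> \<delta>) * (b\<^sub>0 - a\<^sub>0) \<le> exp (\<tau> \<delta>) * (1 / p + 2 * \<delta>)"
        "exp (\<tau> \<delta>) * (b\<^sub>1 - a\<^sub>1) \<le> exp (\<tau> \<delta>) * (1 / p + 2 * \<delta>)"
      using near by (intro mult_left_mono; simp)+
    ultimately have s: "exp T * (b\<^sub>0 - a\<^sub>0) \<le> s * (b\<^sub>1 - a\<^sub>0)"
        "exp T * (b\<^sub>1 - a\<^sub>1) \<le> s * (b\<^sub>1 - a\<^sub>0)"
      unfolding T using \<delta>(2) by linarith+
    have "bridge_family r s L {(x, y). \<exists>n. bridge n x y}"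
      by (rule bridges[OF _ r s]) (simp add: tb(2) S_def)
    then show "\<exists>\<B>. bridge_family r s L \<B> \<and> (fst (Q ! 0), snd (Q ! 1)) \<in> \<B>"
      using bridge_0 unfolding ends by blast
  qed
qed

section \<open>Thickness\<close>

lemma lower_end_gap:
  assumes "0 \<in> K" "K \<subseteq> {0..}"
  shows "{..<0::real} \<in> gaps K"
  unfolding gaps_def in_components_maximal
proof (intro conjI allI impI)
  show "{..<0::real} \<subseteq> - K" using assms(2) by auto
  fix D assume D: "D \<noteq> {} \<and> {..<0} \<subseteq> D \<and> D \<subseteq> - K \<and> connected D"
  have "D \<subseteq> {..<0}"
  proof
    fix x assume "x \<in> D"
    show "x \<in> {..<0}"
    proof (rule ccontr)
      assume "x \<notin> {..<0}"
      moreover have "-1 \<in> {..<0::real}" by simp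
      then have "-1 \<in> D" using D by blast
      ultimately have "{-1..x} \<subseteq> D" using connected_contains_Icc[of D "-1" x] D \<open>x \<in> D\<close> by blast
      then have "0 \<in> D" using \<open>x \<notin> {..<0}\<close> by (auto simp: subset_iff)
      then show False using assms(1) D by auto
    qed
  qed
  then show "D = {..<0}" using D by blast
qed auto

lemma middle_gap:
  assumes "u \<in> K" "v \<in> K" "u < v" "K \<subseteq> {..u} \<union> {v..}"
  shows "{u<..<v::real} \<in> gaps K"
  unfolding gaps_def in_components_maximal
proof (intro conjI allI impI)
  show "{u<..<v} \<subseteq> - K" using assms(4) by auto
  fix D assume D: "D \<noteq> {} \<and> {u<..<v} \<subseteq> D \<and> D \<subseteq> - K \<and> connected D"
  obtain m where m: "u < m" "m < v" using assms(3) dense by blast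
  then have mD: "m \<in> D" using D by auto
  have "D \<subseteq> {u<..<v}"
  proof
    fix x assume x: "x \<in> D"
    show "x \<in> {u<..<v}"
    proof (rule ccontr)
      assume "x \<notin> {u<..<v}"
      then consider "x \<le> u" | "v \<le> x" by auto
      then show False
      proof cases
        case 1
        then have "{x..m} \<subseteq> D" using connected_contains_Icc[of D x m] D x mD by auto
        then have "u \<in> D" using 1 m by auto
        then show False using assms(1) D by auto
      next
        case 2
        then have "{m..x} \<subseteq> D" using connected_contains_Icc[of D m x] D x mD by auto
        then have "v \<in> D" using 2 m by auto
        then show False using assms(2) D by auto
      qed
    qed
  qed
  then show "D = {u<..<v}" using D by blast
qed (use assms in auto)

text \<open>The unbounded gap to the left of 0 counts as larger, so it stops the bridge at
  0.\<close>

lemma left_bridge_subset: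
  assumes "0 \<in> K" "K \<subseteq> {0..}" "0 < u" "u < v"
  shows "left_bridge K {u<..<v::real} \<subseteq> {0..u}"
proof
  fix x assume x: "x \<in> left_bridge K {u<..<v}"
  have "\<not> bounded {..<0::real}"
  proof
    assume "bounded {..<0::real}"
    then obtain c where "\<And>y. y < 0 \<Longrightarrow> \<bar>y\<bar> \<le> (c::real)" by (auto simp: bounded_real)
    from this[of "- \<bar>c\<bar> - 1"] show False by linarith
  qed
  then have "larger_gap K {u<..<v} {..<0}"
    using lower_end_gap[OF assms(1,2)] by (simp add: larger_gap_def)
  moreover have "set_before {..<0} {u<..<v}" using assms by (auto simp: set_before_def)
  ultimately have "set_before {..<0} {x}" using x by (simp add: left_bridge_def)
  then have "x \<ge> 0" by (auto simp: set_before_def intro: dense_le)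
  moreover have "x \<le> u"
  proof (rule ccontr)
    assume "\<not> x \<le> u"
    then obtain y where y: "u < y" "y < min x v" using dense[of u "min x v"] assms by auto
    then have "x \<le> y" using x by (simp add: left_bridge_def set_before_def)
    then show False using y by simp
  qed
  ultimately show "x \<in> {0..u}" by simp
qed

text \<open>For an upper bound the central gap suffices: its left bridge has length at most 1 / p
  and the gap has length 1 - 2 / p. Nonnegativity serves to multiply two such bounds.\<close>

lemma thickness_upper:
  assumes p: "p > 2" and K: "0 \<in> K" "1 / p \<in> K" "1 - 1 / p \<in> K"
    and sub: "K \<subseteq> {0..1 / p} \<union> {1 - 1 / p..1}"
  shows "0 \<le> thickness K" "thickness K \<le> 1 / (p - 2)"
proof -
  let ?U = "{1 / p<..<1 - 1 / p}"
  have ip: "0 < 1 / p" "1 / p < 1 - 1 / p" using p by (auto simp: field_simps)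
  have "?U \<in> gaps K" by (rule middle_gap[OF K(2,3) ip(2)]) (use sub in \<open>auto dest!: subsetD\<close>)
  then have U: "?U \<in> bounded_gaps K" by (simp add: bounded_gaps_def)
  have K0: "K \<subseteq> {0..}" 
  proof
    fix x assume "x \<in> K"
    then have "x \<in> {0..1 / p} \<or> x \<in> {1 - 1 / p..1}" using sub by blast
    then show "x \<in> {0..}" using ip unfolding atLeastAtMost_iff atLeast_iff by linarith
  qed
  have nonneg: "0 \<le> measure lborel A / measure lborel B" for A B :: "real set" by simp
  have "0 \<le> left_thickness K" "0 \<le> right_thickness K"
    unfolding left_thickness_def right_thickness_def using U by (intro cINF_greatest; force)+
  then show "0 \<le> thickness K" by (simp add: thickness_def)
  have m: "measure lborel (left_bridge K ?U) \<le> 1 / p"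
  proof (cases "left_bridge K ?U \<in> sets lborel")
    case True
    have "measure lborel (left_bridge K ?U) \<le> measure lborel {0..1 / p}"
      using left_bridge_subset[OF K(1) K0 ip] True
      by (intro measure_mono_fmeasurable) (auto simp: fmeasurable_compact)
    then show ?thesis using ip by simp
  next
    case False
    \<comment> \<open>The measure of a set that is not measurable is 0 by convention.\<close>
    then show ?thesis using ip by (simp add: measure_notin_sets)
  qed
  have "left_thickness K \<le> measure lborel (left_bridge K ?U) / measure lborel ?U"
    unfolding left_thickness_def
    by (rule cINF_lower[OF _ U]) (intro bdd_belowI2[of _ 0] nonneg)
  also have "\<dots> \<le> (1 / p) / measure lborel ?U" using m by (intro divide_right_mono) auto
  also have "measure lborel ?U = 1 - 2 / p" using ip by simp
  also have "(1 / p) / (1 - 2 / p) = 1 / (p - 2)" using p by (simp add: field_simps)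
  finally show "thickness K \<le> 1 / (p - 2)" by (simp add: thickness_def)
qed

lemma affine_cantor_set_bounds:
  fixes p :: real
  assumes p: "p > 2" and K: "regular_cantor_set K [(0, 1 / p), (1 - 1 / p, 1)] \<phi>"
  shows "0 \<in> K" "1 / p \<in> K" "1 - 1 / p \<in> K" "K \<subseteq> {0..1 / p} \<union> {1 - 1 / p..1}"
proof -
  let ?P = "[(0, 1 / p), (1 - 1 / p, 1)]"
  have ip: "0 < 1 / p" "1 - 1 / p < 1" using p by auto
  have front: "frontier (piece ?P i) \<subseteq> K" if "i < 2" for i
  proof -
    have "\<forall>i<length ?P. frontier (piece ?P i) \<subseteq> K"
      using K unfolding regular_cantor_set_def by (elim conjE)
    then show ?thesis using that by simp
  qed
  have "frontier {0..1 / p} = {0, 1 / p}" "frontier {1 - 1 / p..1} = {1 - 1 / p, 1}"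
    using ip by (auto simp: frontier_def)
  then show "0 \<in> K" "1 / p \<in> K" "1 - 1 / p \<in> K"
    using front[of 0] front[of 1] by (simp_all add: piece_def)
  have "K \<subseteq> pieces ?P" using K unfolding regular_cantor_set_def by (elim conjE)
  moreover have "{..<length ?P} = {0, 1}" by auto
  ultimately show "K \<subseteq> {0..1 / p} \<union> {1 - 1 / p..1}" by (simp add: pieces_def piece_def)
qed

section \<open>Stable intersection and thickness of the given pair\<close>

theorem theorem2:
  fixes \<gamma> p q :: real and K K' :: "real set" and \<phi> \<phi>' :: "real \<Rightarrow> real"
  assumes "\<gamma> = 1.0321" and "p = \<gamma> ^ 40" and "q = \<gamma> ^ 31"
    and "regular_cantor_set K [(0, 1 / p), (1 - 1 / p, 1)] \<phi>"
    and "convex hull K = {0..1}"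
    and "\<forall>x\<in>{0..1 / p}. \<phi> x = p * x"
    and "\<forall>x\<in>{1 - 1 / p..1}. \<phi> x = p * x - p + 1"
    and "regular_cantor_set K' [(0, 1 / q), (1 - 1 / q, 1)] \<phi>'"
    and "convex hull K' = {0..1}"
    and "\<forall>x\<in>{0..1 / q}. \<phi>' x = q * x"
    and "\<forall>x\<in>{1 - 1 / q..1}. \<phi>' x = q * x - q + 1"
  shows "stable_intersection K [(0, 1 / p), (1 - 1 / p, 1)] \<phi>
           K' [(0, 1 / q), (1 - 1 / q, 1)] \<phi>'
         \<and> thickness K * thickness K' < 1"
proof
  let ?P = "[(0, 1 / p), (1 - 1 / p, 1)]" and ?P' = "[(0, 1 / q), (1 - 1 / q, 1)]"
  have pbounds: "3.5389 < p" "p < 3.539" and "0.28257 < 1 / p" "1 / p < 0.282574"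
    and qbounds: "2.663 < q" "q < 2.6631" and "0.375511 < 1 / q" "1 / q < 0.375515"
    unfolding assms(2,3) unfolding assms(1) by (simp_all add: power_divide)
  have p: "p > 2.5" and q: "q > 2.5" using pbounds qbounds by simp_all
  show "stable_intersection K ?P \<phi> K' ?P' \<phi>'"
    unfolding stable_intersection_def
  proof (intro conjI allI impI assms(4,8))
    fix C \<epsilon> C' \<epsilon>' :: real
    assume C: "C > 0" "\<epsilon> > 0" "C' > 0" "\<epsilon>' > 0"
    \<comment> \<open>End points off by less than 0.0004 keep the hull lengths and the coordinate e
      within 0.001 of 1, as \<open>safe_start\<close> requires.\<close>
    have small: "\<forall>\<^sub>F \<delta> in at_right 0. \<delta> < (0.0004::real)"
      by (rule order_tendstoD(2)[OF tendsto_ident_at]) simp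
    have ev: "\<forall>\<^sub>F \<delta> in at_right 0. \<forall>L Q \<eta>. regular_cantor_set L Q \<eta> \<longrightarrow>
        delta_close \<delta> C \<epsilon> ?P \<phi> Q \<eta> \<longrightarrow>
        (\<exists>\<B>. bridge_family 0.28257 0.282574 L \<B> \<and> (fst (Q ! 0), snd (Q ! 1)) \<in> \<B>)"
      by (rule
          close_bridge_family[OF p _ \<open>0.28257 < 1 / p\<close> \<open>1 / p < 0.282574\<close> assms(4,6,7) C(1,2)])
          simp
    have ev': "\<forall>\<^sub>F \<delta> in at_right 0. \<forall>L Q \<eta>. regular_cantor_set L Q \<eta> \<longrightarrow>
        delta_close \<delta> C' \<epsilon>' ?P' \<phi>' Q \<eta> \<longrightarrow>
        (\<exists>\<B>. bridge_family 0.375511 0.375515 L \<B> \<and> (fst (Q ! 0), snd (Q ! 1)) \<in> \<B>)"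
      by (rule
          close_bridge_family[OF q _ \<open>0.375511 < 1 / q\<close> \<open>1 / q < 0.375515\<close> assms(8,10,11) C(3,4)])
          simp
    from eventually_conj[OF eventually_conj[OF ev ev']
        eventually_conj[OF small eventually_at_right_less[of 0]]]
    obtain \<delta> where \<delta>: "0 < \<delta>" "\<delta> < 0.0004"
      and fam: "\<And>L Q \<eta>. regular_cantor_set L Q \<eta> \<Longrightarrow> delta_close \<delta> C \<epsilon> ?P \<phi> Q \<eta> \<Longrightarrow>
        \<exists>\<B>. bridge_family 0.28257 0.282574 L \<B> \<and> (fst (Q ! 0), snd (Q ! 1)) \<in> \<B>"
      and fam': "\<And>L Q \<eta>. regular_cantor_set L Q \<eta> \<Longrightarrow> delta_close \<delta> C' \<epsilon>' ?P' \<phi>' Q \<eta> \<Longrightarrow>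
        \<exists>\<B>. bridge_family 0.375511 0.375515 L \<B> \<and> (fst (Q ! 0), snd (Q ! 1)) \<in> \<B>"
      using eventually_happens'[OF trivial_limit_at_right_real[of 0]] by blast
    show "\<exists>\<delta>>0. \<forall>L Q \<eta> L' Q' \<eta>'. regular_cantor_set L Q \<eta> \<longrightarrow> regular_cantor_set L' Q' \<eta>' \<longrightarrow>
        delta_close \<delta> C \<epsilon> ?P \<phi> Q \<eta> \<longrightarrow> delta_close \<delta> C' \<epsilon>' ?P' \<phi>' Q' \<eta>' \<longrightarrow> L \<inter> L' \<noteq> {}"
    proof (intro exI[of _ \<delta>] conjI allI impI \<delta>(1))
      fix L Q \<eta> L' Q' \<eta>'
      assume L: "regular_cantor_set L Q \<eta>" "regular_cantor_set L' Q' \<eta>'"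
        and close: "delta_close \<delta> C \<epsilon> ?P \<phi> Q \<eta>" "delta_close \<delta> C' \<epsilon>' ?P' \<phi>' Q' \<eta>'"
      obtain \<B> where \<B>: "bridge_family 0.28257 0.282574 L \<B>" "(fst (Q ! 0), snd (Q ! 1)) \<in> \<B>"
        using fam[OF L(1) close(1)] by blast
      obtain \<B>' where \<B>': "bridge_family 0.375511 0.375515 L' \<B>'"
          "(fst (Q' ! 0), snd (Q' ! 1)) \<in> \<B>'"
        using fam'[OF L(2) close(2)] by blast
      have near: "\<bar>fst (Q ! 0)\<bar> < \<delta>" "\<bar>snd (Q ! 1) - 1\<bar> < \<delta>"
        if "delta_close \<delta> C \<epsilon> [(0, 1 / r), (1 - 1 / r, 1)] \<psi> Q \<eta>" for C \<epsilon> r \<psi> Q \<eta>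
      proof -
        have *: "\<bar>fst (Q ! i) - fst ([(0, 1 / r), (1 - 1 / r, 1)] ! i)\<bar> < \<delta> \<and>
            \<bar>snd (Q ! i) - snd ([(0, 1 / r), (1 - 1 / r, 1)] ! i)\<bar> < \<delta>" if "i < 2" for i
          using \<open>delta_close \<delta> C \<epsilon> _ \<psi> Q \<eta>\<close> that by (simp add: delta_close_def)
        show "\<bar>fst (Q ! 0)\<bar> < \<delta>" "\<bar>snd (Q ! 1) - 1\<bar> < \<delta>" using *[of 0] *[of 1] by simp_all
      qed
      have "safe (snd (Q ! 1) - fst (Q ! 0)) (snd (Q' ! 1) - fst (Q' ! 0))
          (snd (Q' ! 1) - fst (Q ! 0)) (snd (Q ! 1) - fst (Q' ! 0))"
        using near[OF close(1)] near[OF close(2)] \<delta>(2) by (intro safe_start) auto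
      moreover have "compact L" "compact L'"
        using L by (auto simp: regular_cantor_set_def cantor_set_def)
      ultimately show "L \<inter> L' \<noteq> {}" using safe_bridges_intersect[OF \<B>(1) \<B>'(1) \<B>(2) \<B>'(2)] by blast
    qed
  qed
  have p2: "p > 2" and q2: "q > 2" using p q by simp_all
  note K = affine_cantor_set_bounds[OF p2 assms(4)] and K' =
      affine_cantor_set_bounds[OF q2 assms(8)]
  have "thickness K * thickness K' \<le> 1 / (p - 2) * (1 / (q - 2))"
    using thickness_upper[OF p2 K] thickness_upper[OF q2 K'] p2 by (intro mult_mono) auto
  also have "\<dots> < 1"
  proof -
    \<comment> \<open>The product on the left is about 1.02, so it exceeds 1.\<close>
    have "1.5389 * 0.663 \<le> (p - 2) * (q - 2)" using pbounds qbounds by (intro mult_mono) auto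
    then show ?thesis using p2 q2 by (simp add: field_simps)
  qed
  finally show "thickness K * thickness K' < 1" .
qed

end
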